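(* Let $(V,\mathcal B,\mu)$, $\rho$, $(\rho_x)_{x\in V}$, $E$, $c$, $\nu$, $R$ and $\widetilde R$ be as in the context. Then the following hold. (1) The operator $\widetilde R$ maps $L^1(E,\rho)$ onto $L^1(V,\mu)$. For any integrable function $f$ on $(E,\rho)$, the relation $\rho(f)=\mu(\widetilde R(f))$ holds. The operator $\widetilde R$ is not one-to-one. (2) If $g\in L^\infty(\mu)$ and $\pi:(x,y)\mapsto x$ is the projection from $V\times V$ to $V$, then $\widetilde R((g\circ\pi)f)=g\,\widetilde R(f)$ for any $f\in L^1(E,\rho)$. (3) The operator $\widetilde R:L^2(c\rho)\to L^2(\mu)$ is bounded and $\|\widetilde R\|_{L^2(c\rho)\to L^2(\mu)}\le 1$. (4) If $c\in L^\infty(\mu)$, then $\widetilde R$ is a bounded operator from $L^2(\rho)$ to $L^2(\mu)$ and $\|\widetilde R\|_{L^2(\rho)\to L^2(\mu)}\le \|c\|_\infty$. (5) For $\pi:E\to V$, $\pi(x,y)=x$, let $U_\pi:L^p(\nu)\to L^p(\rho)$ be the operator acting by the formula $U_\pi:f(x)\mapsto \widetilde f(x,y)$, where $\widetilde f(x,y)=(f\circ\pi)(x,y)$. Then $U_\pi$ is an isometric operator for $p=1,2$. (6) Suppose the function $c(x)$ is such that $L^2(\mu)=L^2(\nu)$. Then $L^2(c\rho)=L^2(\rho)$ and, for any functions $f\in L^2(\mu)$ and $g\in L^2(\rho)$, the relation $$\langle U_\pi f,g\rangle_{L^2(\rho)}=\langle f,\widetilde R(g)\rangle_{L^2(\mu)}$$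 holds. In other words, $\widetilde R=U_\pi^*$ and the operator $\widetilde R$ is a co-isometry. (7) Let $\Pi_x:f(x,y)\mapsto f_x(y)$ be the restriction of $f(x,y)$ onto $\{x\}\times V$. Then, for any $f\in L^p(\rho)$, $p=1,2$, $\widetilde R(f)(x)=(R\circ\Pi_x)(f)(x)$. (8) Suppose that $c\in L^\infty(\mu)$. Then $R:L^2(\mu)\to L^2(\mu)$ is a bounded operator, and $\|R\|_{L^2(\mu)\to L^2(\mu)}\le\|c\|_\infty$. (9) Suppose that the function $x\mapsto\rho_x(A)$ belongs to $L^2(\mu)$ for any $A\in\mathcal B_{\mathrm{fin}}$. Then $R$ is a symmetric unbounded operator in $L^2(\mu)$, i.e. $\langle g,R(f)\rangle_{L^2(\mu)}=\langle R(g),f\rangle_{L^2(\mu)}$. (10) The operator $R:L^1(\nu)\to L^1(\mu)$ is contractive, i.e. $\|R(f)\|_{L^1(\mu)}\le\|f\|_{L^1(\nu)}$ for $f\in L^1(\nu)$. Moreover, for any function $f\in L^1(\nu)$, the formula $$\int_V R(f)\,d\mu(x)=\int_V f(x)c(x)\,d\mu(x)$$ holds. In other words, $\nu=\mu R$ and $\frac{d(\mu R)}{d\mu}(x)=c(x)$.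
   Context: $(V,\mathcal B,\mu)$ is a standard Borel space with a non-atomic infinite $\sigma$-finite measure $\mu$; everything is understood modulo null sets. $\mathcal B_{\mathrm{fin}}=\{A\in\mathcal B:\mu(A)<\infty\}$; under the assumption of (9), $R$ is densely defined in $L^2(\mu)$, being defined on the span of the functions $\chi_A$, $A\in\mathcal B_{\mathrm{fin}}$. $\rho$ is a $\sigma$-finite symmetric measure on $(V\times V,\mathcal B\times\mathcal B)$: $\rho(A\times B)=\rho(B\times A)$ for all $A,B\in\mathcal B$. It is supported by a symmetric Borel set $E\subset V\times V$, and it is disintegrated with respect to $\mu$: there is a measurable family $x\mapsto\rho_x$ of measures on $(V,\mathcal B)$, with $\rho_x$ supported by $E_x=\{y:(x,y)\in E\}$, such that $\rho(f)=\iint f\,d\rho=\int_V\big(\int_V f(x,y)\,d\rho_x(y)\big)d\mu(x)$. The measure $\rho$ is irreducible: for $\mu$-a.e. $x$, $E_x$ is nonempty and uncountable and $(E_x,\rho_x)$ is a standard (non-atomic) measure space. Put $c(x)=\rho_x(V)$; it is assumed that $0<c(x)<\infty$ for $\mu$-a.e. $x$ and $\int_A c\,d\mu<\infty$ for every $A\in\mathcal B_{\mathrm{fin}}$. The measure $\nu$ is given by $d\nu(x)=c(x)\,d\mu(x)$, and $c\rho$ denotes the measure $c(x)\,d\rho(x,y)$. The operators are $$R(f)(x)=\int_V f(y)\,d\rho_x(y)\quad(f\text{ on }V),\qquad \widetilde R(f)(x)=\int_V f(x,y)\,d\rho_x(y)\quad(f\text{ on }V\times V).$$ Notation: $\mu(f)=\int_V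 f\,d\mu$, and $\mu R$ is the measure given by $(\mu R)(f)=\int_V R(f)\,d\mu$.
   Formalization: In (4) the printed bound fails when ‖c‖_∞<1; proved instead: ‖R̃‖² ≤ ‖c‖_∞ always, and ‖R̃‖ ≤ ‖c‖_∞ if ‖c‖_∞ ≥ 1. In (6) the co-isometry claim is proved when L²(μ)=L²(ν) as Hilbert spaces; the rest of (6) already when they agree as sets of functions. *)

theory Defs
  imports "HOL-Probability.Probability"
begin

section \<open>Lebesgue spaces\<close>

text \<open>
  Elements of \<open>L\<^sup>p(M)\<close> are represented by real-valued measurable functions; equality of elements is
  equality almost everywhere. The exponent of \<open>lp\<close> is meant to be a real number \<open>p \<ge> 1\<close>.
\<close>

definition lp :: "real \<Rightarrow> 'a measure \<Rightarrow> ('a \<Rightarrow> real) set" where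
  "lp p M = {f \<in> borel_measurable M. integrable M (\<lambda>x. \<bar>f x\<bar> powr p)}"

definition lp_norm :: "real \<Rightarrow> 'a measure \<Rightarrow> ('a \<Rightarrow> real) \<Rightarrow> real" where
  "lp_norm p M f = (\<integral>x. \<bar>f x\<bar> powr p \<partial>M) powr (1 / p)"

definition l2_inner :: "'a measure \<Rightarrow> ('a \<Rightarrow> real) \<Rightarrow> ('a \<Rightarrow> real) \<Rightarrow> real" where
  "l2_inner M f g = (\<integral>x. f x * g x \<partial>M)"

definition linf :: "'a measure \<Rightarrow> ('a \<Rightarrow> real) set" where
  "linf M = {f \<in> borel_measurable M. esssup M (\<lambda>x. ereal \<bar>f x\<bar>) < \<infinity>}"

definition linf_norm :: "'a measure \<Rightarrow> ('a \<Rightarrow> real) \<Rightarrow> real" where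
  "linf_norm M f = real_of_ereal (esssup M (\<lambda>x. ereal \<bar>f x\<bar>))"

text \<open>
  Equality of \<open>L\<^sup>2(M)\<close> and \<open>L\<^sup>2(N)\<close> as Hilbert spaces; plain equality of the sets of functions is
  \<open>lp 2 M = lp 2 N\<close>.
\<close>

definition l2_eq_hilbert :: "'a measure \<Rightarrow> 'a measure \<Rightarrow> bool" where
  "l2_eq_hilbert M N \<longleftrightarrow> lp 2 M = lp 2 N \<and> (\<forall>f\<in>lp 2 M. \<forall>g\<in>lp 2 M. l2_inner M f g = l2_inner N f g)"

section \<open>Operators between \<open>L\<^sup>p\<close> spaces\<close>

text \<open>
  \<open>ae_linear_on D M N T\<close>: modulo null sets, \<open>T\<close> is a well-defined linear operator on the linear space
  \<open>D\<close> of functions on \<open>M\<close>, with values in functions on \<open>N\<close>.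
\<close>

definition ae_linear_on ::
  "('a \<Rightarrow> real) set \<Rightarrow> 'a measure \<Rightarrow> 'b measure \<Rightarrow> (('a \<Rightarrow> real) \<Rightarrow> 'b \<Rightarrow> real) \<Rightarrow> bool" where
  "ae_linear_on D M N T \<longleftrightarrow>
     (\<forall>f\<in>D. \<forall>g\<in>D. (AE x in M. f x = g x) \<longrightarrow> (AE y in N. T f y = T g y)) \<and>
     (\<forall>f\<in>D. \<forall>g\<in>D. \<forall>a b. (\<lambda>x. a * f x + b * g x) \<in> D \<and>
        (AE y in N. T (\<lambda>x. a * f x + b * g x) y = a * T f y + b * T g y))"

definition lp_operator ::
  "real \<Rightarrow> 'a measure \<Rightarrow> 'b measure \<Rightarrow> (('a \<Rightarrow> real) \<Rightarrow> 'b \<Rightarrow> real) \<Rightarrow> bool" where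
  "lp_operator p M N T \<longleftrightarrow> ae_linear_on (lp p M) M N T \<and> T ` lp p M \<subseteq> lp p N"

definition lp_onto ::
  "real \<Rightarrow> 'a measure \<Rightarrow> 'b measure \<Rightarrow> (('a \<Rightarrow> real) \<Rightarrow> 'b \<Rightarrow> real) \<Rightarrow> bool" where
  "lp_onto p M N T \<longleftrightarrow> (\<forall>h\<in>lp p N. \<exists>f\<in>lp p M. AE y in N. T f y = h y)"

definition lp_one_to_one ::
  "real \<Rightarrow> 'a measure \<Rightarrow> 'b measure \<Rightarrow> (('a \<Rightarrow> real) \<Rightarrow> 'b \<Rightarrow> real) \<Rightarrow> bool" where
  "lp_one_to_one p M N T \<longleftrightarrow>
     (\<forall>f\<in>lp p M. \<forall>g\<in>lp p M. (AE y in N. T f y = T g y) \<longrightarrow> (AE x in M. f x = g x))"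

definition bounded_lp_operator ::
  "real \<Rightarrow> 'a measure \<Rightarrow> 'b measure \<Rightarrow> (('a \<Rightarrow> real) \<Rightarrow> 'b \<Rightarrow> real) \<Rightarrow> bool" where
  "bounded_lp_operator p M N T \<longleftrightarrow> lp_operator p M N T \<and>
     (\<exists>K\<ge>0. \<forall>f\<in>lp p M. lp_norm p N (T f) \<le> K * lp_norm p M f)"

definition lp_opnorm ::
  "real \<Rightarrow> 'a measure \<Rightarrow> 'b measure \<Rightarrow> (('a \<Rightarrow> real) \<Rightarrow> 'b \<Rightarrow> real) \<Rightarrow> real" where
  "lp_opnorm p M N T = Inf {K. 0 \<le> K \<and> (\<forall>f\<in>lp p M. lp_norm p N (T f) \<le> K * lp_norm p M f)}"

definition lp_contraction ::
  "real \<Rightarrow> 'a measure \<Rightarrow> 'b measure \<Rightarrow> (('a \<Rightarrow> real) \<Rightarrow> 'b \<Rightarrow> real) \<Rightarrow> bool" where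
  "lp_contraction p M N T \<longleftrightarrow> lp_operator p M N T \<and>
     (\<forall>f\<in>lp p M. lp_norm p N (T f) \<le> lp_norm p M f)"

definition lp_isometry ::
  "real \<Rightarrow> 'a measure \<Rightarrow> 'b measure \<Rightarrow> (('a \<Rightarrow> real) \<Rightarrow> 'b \<Rightarrow> real) \<Rightarrow> bool" where
  "lp_isometry p M N T \<longleftrightarrow> lp_operator p M N T \<and>
     (\<forall>f\<in>lp p M. lp_norm p N (T f) = lp_norm p M f)"

text \<open>
  \<open>S\<close> is the adjoint of the everywhere defined operator \<open>T : L\<^sup>2(M) \<rightarrow> L\<^sup>2(N)\<close>.
\<close>

definition l2_adjoint ::
  "'a measure \<Rightarrow> 'b measure \<Rightarrow> (('a \<Rightarrow> real) \<Rightarrow> 'b \<Rightarrow> real) \<Rightarrow> (('b \<Rightarrow> real) \<Rightarrow> 'a \<Rightarrow> real) \<Rightarrow> bool" where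
  "l2_adjoint M N T S \<longleftrightarrow> lp_operator 2 M N T \<and> lp_operator 2 N M S \<and>
     (\<forall>f\<in>lp 2 M. \<forall>g\<in>lp 2 N. l2_inner N (T f) g = l2_inner M f (S g))"

definition l2_co_isometry ::
  "'a measure \<Rightarrow> 'b measure \<Rightarrow> (('a \<Rightarrow> real) \<Rightarrow> 'b \<Rightarrow> real) \<Rightarrow> bool" where
  "l2_co_isometry M N T \<longleftrightarrow> bounded_lp_operator 2 M N T \<and>
     (\<exists>S. l2_adjoint M N T S \<and> lp_isometry 2 N M S)"

text \<open>
  A symmetric operator in \<open>L\<^sup>2(M)\<close> with dense domain \<open>D\<close>. As usual for ``unbounded operators'',
  boundedness is not required, but it is not excluded either.
\<close>

definition symmetric_l2_operator ::
  "'a measure \<Rightarrow> ('a \<Rightarrow> real) set \<Rightarrow> (('a \<Rightarrow> real) \<Rightarrow> 'a \<Rightarrow> real) \<Rightarrow> bool" where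
  "symmetric_l2_operator M D T \<longleftrightarrow>
     D \<subseteq> lp 2 M \<and>
     (\<forall>f\<in>lp 2 M. \<forall>e>0. \<exists>h\<in>D. lp_norm 2 M (\<lambda>x. f x - h x) < e) \<and>
     ae_linear_on D M M T \<and> T ` D \<subseteq> lp 2 M \<and>
     (\<forall>f\<in>D. \<forall>g\<in>D. l2_inner M g (T f) = l2_inner M (T g) f)"

section \<open>Symmetric measures and the associated operators\<close>

definition nonatomic :: "'a measure \<Rightarrow> bool" where
  "nonatomic M \<longleftrightarrow> (\<forall>A\<in>sets M. 0 < emeasure M A \<longrightarrow>
     (\<exists>B\<in>sets M. B \<subseteq> A \<and> 0 < emeasure M B \<and> emeasure M B < emeasure M A))"

definition Bfin :: "'a measure \<Rightarrow> 'a set set" where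
  "Bfin M = {A \<in> sets M. emeasure M A < \<infinity>}"

text \<open>The linear span of the characteristic functions of the sets in \<open>Bfin M\<close>.\<close>

definition span_Bfin :: "'a measure \<Rightarrow> ('a \<Rightarrow> real) set" where
  "span_Bfin M = {f. \<exists>F a. finite F \<and> F \<subseteq> Bfin M \<and> f = (\<lambda>x. \<Sum>A\<in>F. a A * indicator A x)}"

definition mass :: "('a \<Rightarrow> 'a measure) \<Rightarrow> 'a \<Rightarrow> ennreal" where
  "mass \<kappa> x = emeasure (\<kappa> x) UNIV"

text \<open>
  The real-valued version of \<open>c(x) = \<rho>\<^sub>x(V)\<close>; it differs from \<open>mass\<close> only on the null set where
  \<open>\<rho>\<^sub>x\<close> is infinite.
\<close>

definition rmass :: "('a \<Rightarrow> 'a measure) \<Rightarrow> 'a \<Rightarrow> real" where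
  "rmass \<kappa> x = enn2real (mass \<kappa> x)"

text \<open>
  Every standard Borel space is isomorphic to a Polish space with its Borel sets, so \<open>V\<close> is a type of
  class \<open>polish_space\<close>; the measure \<open>\<rho>\<^sub>x\<close> is \<open>\<kappa> x\<close>. Measurability of the family \<open>\<kappa>\<close> is the
  measurability in \<open>x\<close> of \<open>\<rho>\<^sub>x\<close> on sections of product-measurable sets, so that the iterated integral in
  the disintegration formula makes sense; for families of finite measures this is equivalent
  to the measurability of \<open>x \<mapsto> \<rho>\<^sub>x(A)\<close> for all Borel \<open>A\<close>.
\<close>

locale symmetric_measure_system =
  fixes \<mu> :: "'a::polish_space measure"
    and \<rho> :: "('a \<times> 'a) measure"
    and E :: "('a \<times> 'a) set"
    and \<kappa> :: "'a \<Rightarrow> 'a measure"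
  assumes sets_mu: "sets \<mu> = sets borel"
    and sigma_finite_mu: "sigma_finite_measure \<mu>"
    and infinite_mu: "emeasure \<mu> UNIV = \<infinity>"
    and nonatomic_mu: "nonatomic \<mu>"
    and sets_rho: "sets \<rho> = sets (borel \<Otimes>\<^sub>M borel)"
    and sigma_finite_rho: "sigma_finite_measure \<rho>"
    and symmetric_rho:
      "\<And>A B. A \<in> sets borel \<Longrightarrow> B \<in> sets borel \<Longrightarrow> emeasure \<rho> (A \<times> B) = emeasure \<rho> (B \<times> A)"
    and borel_E: "E \<in> sets (borel \<Otimes>\<^sub>M borel)"
    and sym_E: "sym E"
    and supported_rho: "emeasure \<rho> (- E) = 0"
    and sets_kernel: "\<And>x. sets (\<kappa> x) = sets borel"
    and measurable_kernel:
      "\<And>C. C \<in> sets (borel \<Otimes>\<^sub>M borel) \<Longrightarrow> (\<lambda>x. emeasure (\<kappa> x) (Pair x -` C)) \<in> borel_measurable borel"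
    and supported_kernel: "AE x in \<mu>. emeasure (\<kappa> x) (- (E `` {x})) = 0"
    and disintegration:
      "\<And>f. f \<in> borel_measurable (borel \<Otimes>\<^sub>M borel) \<Longrightarrow>
         (\<integral>\<^sup>+z. f z \<partial>\<rho>) = (\<integral>\<^sup>+x. (\<integral>\<^sup>+y. f (x, y) \<partial>\<kappa> x) \<partial>\<mu>)"
    and irreducible:
      "AE x in \<mu>. E `` {x} \<noteq> {} \<and> uncountable (E `` {x}) \<and> nonatomic (restrict_space (\<kappa> x) (E `` {x}))"
    and mass_finite: "AE x in \<mu>. 0 < mass \<kappa> x \<and> mass \<kappa> x < \<infinity>"
    and mass_locally_integrable: "\<And>A. A \<in> Bfin \<mu> \<Longrightarrow> (\<integral>\<^sup>+x\<in>A. mass \<kappa> x \<partial>\<mu>) < \<infinity>"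

definition nu :: "'a measure \<Rightarrow> ('a \<Rightarrow> 'a measure) \<Rightarrow> 'a measure" where
  "nu \<mu> \<kappa> = density \<mu> (mass \<kappa>)"

definition crho :: "('a \<times> 'a) measure \<Rightarrow> ('a \<Rightarrow> 'a measure) \<Rightarrow> ('a \<times> 'a) measure" where
  "crho \<rho> \<kappa> = density \<rho> (\<lambda>(x, y). mass \<kappa> x)"

definition R_op :: "('a \<Rightarrow> 'a measure) \<Rightarrow> ('a \<Rightarrow> real) \<Rightarrow> 'a \<Rightarrow> real" where
  "R_op \<kappa> f x = (\<integral>y. f y \<partial>\<kappa> x)"

definition Rt_op :: "('a \<Rightarrow> 'a measure) \<Rightarrow> ('a \<times> 'a \<Rightarrow> real) \<Rightarrow> 'a \<Rightarrow> real" where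
  "Rt_op \<kappa> f x = (\<integral>y. f (x, y) \<partial>\<kappa> x)"

definition slice :: "'a \<Rightarrow> ('a \<times> 'a \<Rightarrow> real) \<Rightarrow> 'a \<Rightarrow> real" where
  "slice x f = (\<lambda>y. f (x, y))"

text \<open>
  The Bochner integral of a non-integrable function is 0. The following are the functions for which the
  integrals defining \<open>R_op\<close> and \<open>Rt_op\<close> genuinely exist for almost every \<open>x\<close>.
\<close>

definition R_dom :: "'a measure \<Rightarrow> ('a \<Rightarrow> 'a measure) \<Rightarrow> ('a \<Rightarrow> real) set" where
  "R_dom \<mu> \<kappa> = {f. AE x in \<mu>. integrable (\<kappa> x) f}"

definition Rt_dom :: "'a measure \<Rightarrow> ('a \<Rightarrow> 'a measure) \<Rightarrow> ('a \<times> 'a \<Rightarrow> real) set" where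
  "Rt_dom \<mu> \<kappa> = {f. AE x in \<mu>. integrable (\<kappa> x) (slice x f)}"

definition U_op :: "('a \<Rightarrow> real) \<Rightarrow> 'a \<times> 'a \<Rightarrow> real" where
  "U_op f = f \<circ> fst"

definition muR :: "'a measure \<Rightarrow> ('a \<Rightarrow> 'a measure) \<Rightarrow> 'a measure" where
  "muR \<mu> \<kappa> = measure_of (space \<mu>) (sets \<mu>) (\<lambda>A. \<integral>\<^sup>+x. (\<integral>\<^sup>+y. indicator A y \<partial>\<kappa> x) \<partial>\<mu>)"

end

theory Submission
  imports Defs
begin

text \<open>
  Disintegration turns integrals over \<open>\<rho>\<close> into iterated integrals, so both operators are obtained by
  integrating over the fibres \<open>\<rho>\<^sub>x\<close>, and the norm estimates reduce to facts about one finite measure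
  \<open>\<rho>\<^sub>x\<close> at a time. For exponent 1 this is Fubini's theorem (\<open>Rt_op_integral\<close>). For exponent 2
  it is the Cauchy-Schwarz inequality \<open>(\<integral> f d\<rho>\<^sub>x)\<^sup>2 \<le> c(x) \<integral> f\<^sup>2 d\<rho>\<^sub>x\<close> (\<open>square_Rt_op_le\<close>), whose right-hand
  side integrates to the square of the norm in \<open>L\<^sup>2(c\<rho>)\<close>, and is at most \<open>\<parallel>c\<parallel>\<^sub>\<infinity>\<close> times the square of the norm
  in \<open>L\<^sup>2(\<rho>)\<close>.

  Symmetry says that the flip of the two coordinates preserves \<open>\<rho>\<close> (\<open>distr_rho_swap\<close>). Since the first
  marginal of \<open>\<rho>\<close> is \<open>\<nu> = c\<mu>\<close>, so is the second one (\<open>distr_rho_snd\<close>). Hence composition with either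
  projection is an isometry from \<open>L\<^sup>p(\<nu>)\<close> to \<open>L\<^sup>p(\<rho>)\<close>. The first projection yields the isometry \<open>U\<close>;
  the second one expresses \<open>R f\<close> as the fibre integral of \<open>f \<circ> snd\<close>, so that everything about
  \<open>R\<close> follows from the corresponding fact about fibre integrals. In particular the square root of
  \<open>\<parallel>c\<parallel>\<^sub>\<infinity>\<close> enters the bound for \<open>R\<close> on \<open>L\<^sup>2(\<mu>)\<close> twice, once from each factor. The symmetry of \<open>R\<close> is the
  invariance of \<open>\<integral> g(x) f(y) d\<rho>(x,y)\<close> under the flip, and \<open>\<nu> = \<mu>R\<close> is the formula for the second
  marginal.

  Three points need an idea of their own. The fibre integral is not injective because some fixed
  Borel set \<open>A\<close> splits \<open>\<rho>\<^sub>x\<close> into two nontrivial parts for a non-null set of points \<open>x\<close>: otherwise almost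
  every \<open>\<rho>\<^sub>x\<close> would be trivial on a countable base, hence on all Borel sets, contradicting
  non-atomicity (\<open>ex_kernel_splitting_set\<close>). Functions living over \<open>A\<close> and over its complement can then
  have the same fibre integral. Equality of \<open>L\<^sup>2(\<mu>)\<close> and \<open>L\<^sup>2(\<nu>)\<close> is carried over to the product by
  testing it on \<open>x \<mapsto> \<parallel>g(x,\<cdot>)\<parallel>\<close>, the norm in \<open>L\<^sup>2(\<rho>\<^sub>x)\<close> (\<open>lp_2_crho_eq_lp_2_rho\<close>); if moreover the inner
  products agree, then \<open>\<nu> = \<mu>\<close>, and the fibre integral is the adjoint of an isometry. Finally, the
  domain of the unbounded operator \<open>R\<close> is dense because simple functions are
  (\<open>span_Bfin_dense\<close>).
\<close>

section \<open>Lebesgue spaces with exponents 1 and 2\<close>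

lemma lp_1_iff: "f \<in> lp 1 M \<longleftrightarrow> integrable M f"
  by (auto simp: lp_def integrable_abs_iff)

lemma lp_2_iff: "f \<in> lp 2 M \<longleftrightarrow> f \<in> borel_measurable M \<and> integrable M (\<lambda>x. (f x)\<^sup>2)"
  by (auto simp: lp_def)

lemma lp_2_iff_nn_integral:
  "f \<in> lp 2 M \<longleftrightarrow> f \<in> borel_measurable M \<and> (\<integral>\<^sup>+x. ennreal ((f x)\<^sup>2) \<partial>M) < \<infinity>"
  by (auto simp: lp_2_iff integrable_iff_bounded)

lemma lp_norm_1: "lp_norm 1 M f = (\<integral>x. \<bar>f x\<bar> \<partial>M)"
  by (simp add: lp_norm_def)

lemma lp_norm_2: "lp_norm 2 M f = sqrt (\<integral>x. (f x)\<^sup>2 \<partial>M)"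
  by (simp add: lp_norm_def powr_half_sqrt)

lemma lp_measurable: "f \<in> lp p M \<Longrightarrow> f \<in> borel_measurable M"
  by (simp add: lp_def)

lemma lp_linear_combination:
  assumes "p \<in> {1, 2}" "f \<in> lp p M" "g \<in> lp p M"
  shows "(\<lambda>x. a * f x + b * g x) \<in> lp p M"
proof (cases "p = 1")
  case True
  then show ?thesis using assms by (auto simp: lp_1_iff)
next
  case False
  then have p: "p = 2" using assms by auto
  have f: "f \<in> borel_measurable M" "integrable M (\<lambda>x. (f x)\<^sup>2)"
    and g: "g \<in> borel_measurable M" "integrable M (\<lambda>x. (g x)\<^sup>2)"
    using assms by (auto simp: p lp_2_iff)
  note f(1)[measurable] g(1)[measurable]
  have "integrable M (\<lambda>x. (a * f x + b * g x)\<^sup>2)"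
  proof (rule Bochner_Integration.integrable_bound)
    show "integrable M (\<lambda>x. 2 * a\<^sup>2 * (f x)\<^sup>2 + 2 * b\<^sup>2 * (g x)\<^sup>2)"
      using f g by auto
    have "(a * u + b * v)\<^sup>2 \<le> 2 * a\<^sup>2 * u\<^sup>2 + 2 * b\<^sup>2 * v\<^sup>2" for u v
      using zero_le_power2[of "a * u - b * v"] by (simp add: power2_eq_square algebra_simps)
    then show "AE x in M. norm ((a * f x + b * g x)\<^sup>2) \<le> norm (2 * a\<^sup>2 * (f x)\<^sup>2 + 2 * b\<^sup>2 * (g x)\<^sup>2)"
      by (auto intro!: AE_I2 order_trans[OF _ abs_ge_self])
  qed measurable
  then show ?thesis by (simp add: p lp_2_iff)
qed

lemma lp_cong_AE:
  assumes "f \<in> lp p M" "g \<in> borel_measurable M" "AE x in M. f x = g x"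
  shows "g \<in> lp p M"
proof -
  have "integrable M (\<lambda>x. \<bar>f x\<bar> powr p)" "f \<in> borel_measurable M"
    using assms by (auto simp: lp_def)
  then have "integrable M (\<lambda>x. \<bar>g x\<bar> powr p)"
    using assms(2,3) by (subst integrable_cong_AE[where g="\<lambda>x. \<bar>f x\<bar> powr p"]) auto
  then show ?thesis using assms by (simp add: lp_def)
qed

lemma integrable_mult_lp_2:
  assumes "f \<in> lp 2 M" "g \<in> lp 2 M"
  shows "integrable M (\<lambda>x. f x * g x)"
proof (rule Bochner_Integration.integrable_bound)
  show "integrable M (\<lambda>x. (f x)\<^sup>2 + (g x)\<^sup>2)" using assms by (auto simp: lp_2_iff)
  show "(\<lambda>x. f x * g x) \<in> borel_measurable M" using assms by (auto simp: lp_2_iff)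
  have "\<bar>u * v\<bar> \<le> \<bar>u\<^sup>2 + v\<^sup>2\<bar>" for u v :: real
  proof -
    have "2 * (\<bar>u\<bar> * \<bar>v\<bar>) \<le> u\<^sup>2 + v\<^sup>2" using sum_squares_bound[of "\<bar>u\<bar>" "\<bar>v\<bar>"] by simp
    moreover have "0 \<le> \<bar>u\<bar> * \<bar>v\<bar>" by simp
    ultimately show ?thesis unfolding abs_mult by linarith
  qed
  then show "AE x in M. norm (f x * g x) \<le> norm ((f x)\<^sup>2 + (g x)\<^sup>2)" by simp
qed

lemma indicator_in_lp_2:
  assumes "A \<in> Bfin M"
  shows "(indicator A :: 'a \<Rightarrow> real) \<in> lp 2 M"
proof -
  have "(\<lambda>x. (indicator A x)\<^sup>2) = (indicator A :: 'a \<Rightarrow> real)"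
    by (auto split: split_indicator)
  then show ?thesis using assms by (auto simp: lp_2_iff Bfin_def)
qed

text \<open>
  The hypothesis compares nonnegative integrals, so that the bound yields both membership in \<open>L\<^sup>2\<close> and the
  estimate of the norms.
\<close>

lemma lp_2_bound:
  assumes f: "f \<in> lp 2 M" and g: "g \<in> borel_measurable N" and K: "0 \<le> K"
    and le: "(\<integral>\<^sup>+x. ennreal ((g x)\<^sup>2) \<partial>N) \<le> ennreal K * (\<integral>\<^sup>+x. ennreal ((f x)\<^sup>2) \<partial>M)"
  shows "g \<in> lp 2 N" "lp_norm 2 N g \<le> sqrt K * lp_norm 2 M f"
proof -
  have f2: "integrable M (\<lambda>x. (f x)\<^sup>2)" using f by (auto simp: lp_2_iff)
  have eq: "(\<integral>\<^sup>+x. ennreal ((f x)\<^sup>2) \<partial>M) = ennreal (\<integral>x. (f x)\<^sup>2 \<partial>M)"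
    using f2 by (simp add: nn_integral_eq_integral)
  have le': "(\<integral>\<^sup>+x. ennreal ((g x)\<^sup>2) \<partial>N) \<le> ennreal (K * (\<integral>x. (f x)\<^sup>2 \<partial>M))"
    using le K by (simp add: eq ennreal_mult')
  then have "(\<integral>\<^sup>+x. ennreal ((g x)\<^sup>2) \<partial>N) < \<infinity>"
    using le_less_trans by (fastforce simp: ennreal_less_top)
  then show g2: "g \<in> lp 2 N" using g by (auto simp: lp_2_iff_nn_integral)
  then have "ennreal (\<integral>x. (g x)\<^sup>2 \<partial>N) \<le> ennreal (K * (\<integral>x. (f x)\<^sup>2 \<partial>M))"
    using le' by (simp add: lp_2_iff nn_integral_eq_integral)
  then have "(\<integral>x. (g x)\<^sup>2 \<partial>N) \<le> K * (\<integral>x. (f x)\<^sup>2 \<partial>M)"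
    by (rule ennreal_le_iff[THEN iffD1, rotated]) (use K in auto)
  then show "lp_norm 2 N g \<le> sqrt K * lp_norm 2 M f"
    unfolding lp_norm_2 by (metis real_sqrt_le_iff real_sqrt_mult)
qed

lemma bounded_lp_operatorI:
  assumes "lp_operator p M N T" "0 \<le> K" "\<And>f. f \<in> lp p M \<Longrightarrow> lp_norm p N (T f) \<le> K * lp_norm p M f"
  shows "bounded_lp_operator p M N T" "lp_opnorm p M N T \<le> K"
proof -
  show "bounded_lp_operator p M N T" using assms by (auto simp: bounded_lp_operator_def)
  show "lp_opnorm p M N T \<le> K"
    unfolding lp_opnorm_def
    by (rule cInf_lower) (use assms in \<open>auto intro!: bdd_belowI[of _ 0]\<close>)
qed

text \<open>
  Boundedness makes the infimum run over a nonempty set; the infimum of the empty set of reals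
  has no specified sign.
\<close>

lemma lp_opnorm_nonneg:
  assumes "bounded_lp_operator p M N T"
  shows "0 \<le> lp_opnorm p M N T"
  unfolding lp_opnorm_def
  by (rule cInf_greatest) (use assms in \<open>auto simp: bounded_lp_operator_def\<close>)

lemma lp_distr_iff:
  assumes T: "T \<in> measurable M N" and N': "distr M N T = N'" and f: "f \<in> borel_measurable N"
  shows "f \<in> lp p N' \<longleftrightarrow> f \<circ> T \<in> lp p M"
proof -
  have "integrable N' (\<lambda>x. \<bar>f x\<bar> powr p) \<longleftrightarrow> integrable M (\<lambda>x. \<bar>f (T x)\<bar> powr p)"
    unfolding N'[symmetric] using f by (intro integrable_distr_eq[OF T]) auto
  moreover have "f \<in> borel_measurable N'" using f by (simp add: N'[symmetric])
  ultimately show ?thesis using measurable_comp[OF T f] by (simp add: lp_def comp_def)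
qed

lemma lp_norm_distr:
  assumes T: "T \<in> measurable M N" and N': "distr M N T = N'" and f: "f \<in> borel_measurable N"
  shows "lp_norm p M (f \<circ> T) = lp_norm p N' f"
  unfolding lp_norm_def N'[symmetric] using f by (subst integral_distr[OF T]) auto

text \<open>
  On a null space the essential supremum of \<open>\<bar>f\<bar>\<close> would be \<open>-\<infinity>\<close>; otherwise it is nonnegative, so that its
  real value is still a bound.
\<close>

lemma linf_AE_bound:
  assumes "f \<in> linf M" and "emeasure M (space M) \<noteq> 0"
  shows "AE x in M. \<bar>f x\<bar> \<le> linf_norm M f" "0 \<le> linf_norm M f"
proof -
  let ?s = "esssup M (\<lambda>x. ereal \<bar>f x\<bar>)"
  have ae: "AE x in M. ereal \<bar>f x\<bar> \<le> ?s" by (rule esssup_AE)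
  have "0 \<le> ?s"
  proof (rule ccontr)
    assume "\<not> 0 \<le> ?s"
    from ae have "AE x in M. False"
    proof eventually_elim
      case (elim x)
      have "0 \<le> ereal \<bar>f x\<bar>" by simp
      with elim \<open>\<not> 0 \<le> ?s\<close> show False using order_trans by blast
    qed
    with assms(2) show False by (simp add: AE_iff_null null_sets_def)
  qed
  moreover have "?s < \<infinity>" using assms by (auto simp: linf_def)
  ultimately have s: "?s = ereal (linf_norm M f)" "0 \<le> linf_norm M f"
    unfolding linf_norm_def by (auto simp: ereal_real real_of_ereal_pos)
  show "0 \<le> linf_norm M f" by fact
  show "AE x in M. \<bar>f x\<bar> \<le> linf_norm M f" using ae unfolding s(1) by simp
qed

lemma (in finite_measure) square_nn_integral_abs_le:
  assumes [measurable]: "f \<in> borel_measurable M"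
  shows "(\<integral>\<^sup>+x. ennreal \<bar>f x\<bar> \<partial>M)\<^sup>2 \<le> emeasure M (space M) * (\<integral>\<^sup>+x. ennreal ((f x)\<^sup>2) \<partial>M)"
  using Cauchy_Schwarz_nn_integral[of "\<lambda>x. ennreal \<bar>f x\<bar>" M "\<lambda>_. 1"]
  by (simp add: ennreal_power mult.commute)

lemma ennreal_abs_integral_le:
  "ennreal \<bar>\<integral>x. f x \<partial>M\<bar> \<le> (\<integral>\<^sup>+x. ennreal \<bar>f x\<bar> \<partial>M)" for f :: "'a \<Rightarrow> real"
proof (cases "integrable M f")
  case True
  then show ?thesis using integral_norm_bound_ennreal[of M f] by simp
qed (simp add: not_integrable_integral_eq)

section \<open>Step functions on sets of finite measure are dense in the square integrable functions\<close>

lemma span_Bfin_induct [consumes 1, case_names zero add]: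
  assumes "f \<in> span_Bfin M" "P (\<lambda>_. 0)"
    and step: "\<And>f a A. P f \<Longrightarrow> A \<in> Bfin M \<Longrightarrow> P (\<lambda>x. a * indicator A x + f x)"
  shows "P f"
proof -
  obtain F a where F: "finite F" "F \<subseteq> Bfin M" and f: "f = (\<lambda>x. \<Sum>A\<in>F. a A * indicator A x)"
    using assms(1) by (auto simp: span_Bfin_def)
  from F have "P (\<lambda>x. \<Sum>A\<in>F. a A * indicator A x)"
  proof (induction F rule: finite_induct)
    case (insert A F)
    then show ?case using step[of "\<lambda>x. \<Sum>A\<in>F. a A * indicator A x" A "a A"]
      by (simp del: sum_mult_indicator)
  qed (simp add: assms(2))
  then show ?thesis by (simp add: f)
qed

text \<open>
  Both functions are expanded over the union of their families of sets, with coefficient 0 where a set is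
  missing.
\<close>

lemma span_Bfin_linear_combination:
  assumes "f \<in> span_Bfin M" "g \<in> span_Bfin M"
  shows "(\<lambda>x. a * f x + b * g x) \<in> span_Bfin M"
proof -
  obtain F u where F: "finite F" "F \<subseteq> Bfin M" and f: "f = (\<lambda>x. \<Sum>A\<in>F. u A * indicator A x)"
    using assms(1) by (auto simp: span_Bfin_def)
  obtain G v where G: "finite G" "G \<subseteq> Bfin M" and g: "g = (\<lambda>x. \<Sum>A\<in>G. v A * indicator A x)"
    using assms(2) by (auto simp: span_Bfin_def)
  define w where "w A = a * (if A \<in> F then u A else 0) + b * (if A \<in> G then v A else 0)" for A
  have "f x = (\<Sum>A\<in>F \<union> G. (if A \<in> F then u A else 0) * indicator A x)" for x
    unfolding f using F G by (intro sum.mono_neutral_cong_left) auto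
  moreover have "g x = (\<Sum>A\<in>F \<union> G. (if A \<in> G then v A else 0) * indicator A x)" for x
    unfolding g using F G by (intro sum.mono_neutral_cong_left) auto
  ultimately have "(\<lambda>x. a * f x + b * g x) = (\<lambda>x. \<Sum>A\<in>F \<union> G. w A * indicator A x)"
    by (simp add: w_def fun_eq_iff sum_distrib_left sum.distrib[symmetric] algebra_simps)
  then show ?thesis
    unfolding span_Bfin_def using F G by (intro CollectI exI[of _ "F \<union> G"] exI[of _ w]) auto
qed

lemma zero_in_span_Bfin: "(\<lambda>_. 0) \<in> span_Bfin M"
  unfolding span_Bfin_def by (intro CollectI exI[of _ "{}"]) auto

lemma indicator_in_span_Bfin: "A \<in> Bfin M \<Longrightarrow> indicator A \<in> span_Bfin M"
  unfolding span_Bfin_def by (intro CollectI exI[of _ "{A}"] exI[of _ "\<lambda>_. 1"]) auto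

lemma span_Bfin_subset_lp_2: "span_Bfin M \<subseteq> lp 2 M"
proof
  fix f assume "f \<in> span_Bfin M"
  then show "f \<in> lp 2 M"
  proof (induction rule: span_Bfin_induct)
    case (add f a A)
    then show ?case
      using lp_linear_combination[of 2 "indicator A" M f a 1] indicator_in_lp_2[of A M] by simp
  qed (simp add: lp_2_iff)
qed

lemma span_Bfin_bounded: "f \<in> span_Bfin M \<Longrightarrow> \<exists>K. \<forall>x. \<bar>f x\<bar> \<le> K"
proof (induction rule: span_Bfin_induct)
  case (add f a A)
  then obtain K where "\<bar>f x\<bar> \<le> K" for x by blast
  then have "\<bar>a * indicator A x + f x\<bar> \<le> \<bar>a\<bar> + K" for x
    by (auto intro!: order_trans[OF abs_triangle_ineq] add_mono split: split_indicator)
      (metis abs_ge_zero add_increasing)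
  then show ?case by blast
qed auto

text \<open>
  A nonzero value \<open>y\<close> is taken on a set of finite measure, because \<open>y\<^sup>2\<close> times the indicator of that
  set is dominated by the integrable square.
\<close>

lemma simple_function_in_span_Bfin:
  assumes s: "simple_function M s" and s2: "s \<in> lp 2 M" and space: "space M = UNIV"
  shows "s \<in> span_Bfin M"
proof -
  have fin: "finite (range s)" using s space by (simp add: simple_function_def)
  have level: "s -` {y} \<in> Bfin M" if "y \<noteq> 0" for y
  proof -
    have meas: "s -` {y} \<in> sets M"
      using lp_measurable[OF s2] space measurable_sets[of s M borel "{y}"] by simp
    have "integrable M (\<lambda>x. indicator (s -` {y}) x * y\<^sup>2)"
    proof (rule Bochner_Integration.integrable_bound)
      show "integrable M (\<lambda>x. (s x)\<^sup>2)" using s2 by (simp add: lp_2_iff)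
    qed (use meas in \<open>auto split: split_indicator\<close>)
    then have "integrable M (\<lambda>x. indicator (s -` {y}) x * y\<^sup>2 * inverse (y\<^sup>2))"
      by (rule integrable_mult_left)
    then have "integrable M (indicator (s -` {y}) :: 'a \<Rightarrow> real)"
      using that by (simp add: mult.assoc)
    then show ?thesis
      using meas space by (simp add: Bfin_def integrable_indicator_iff)
  qed
  have "(\<lambda>x. \<Sum>y\<in>Y. y * indicator (s -` {y}) x) \<in> span_Bfin M" if "finite Y" for Y :: "real set"
    using that
  proof (induction Y rule: finite_induct)
    case (insert y Y)
    show ?case
    proof (cases "y = 0")
      case False
      from span_Bfin_linear_combination[OF indicator_in_span_Bfin[OF level[OF this]] insert.IH, of y 1]
      show ?thesis using insert.hyps by (simp del: sum_mult_indicator)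
    qed (use insert in \<open>simp del: sum_mult_indicator\<close>)
  qed (simp add: zero_in_span_Bfin)
  moreover have "s = (\<lambda>x. \<Sum>y\<in>range s. y * indicator (s -` {y}) x)"
  proof
    fix x
    have "(\<Sum>y\<in>range s. y * indicator (s -` {y}) x) = (\<Sum>y\<in>{s x}. y * indicator (s -` {y}) x)"
      using fin by (intro sum.mono_neutral_right) auto
    then show "s x = (\<Sum>y\<in>range s. y * indicator (s -` {y}) x)" by simp
  qed
  ultimately show ?thesis using fin by metis
qed

text \<open>
  Simple functions \<open>s\<^sub>i\<close> converging to \<open>f\<close> with \<open>\<bar>s\<^sub>i\<bar> \<le> 2\<bar>f\<bar>\<close> converge in \<open>L\<^sup>2\<close> by dominated convergence: the
  squared difference is at most \<open>9f\<^sup>2\<close>.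
\<close>

lemma span_Bfin_dense:
  assumes f: "f \<in> lp 2 M" and space: "space M = UNIV" and e: "0 < e"
  shows "\<exists>h\<in>span_Bfin M. lp_norm 2 M (\<lambda>x. f x - h x) < e"
proof -
  have [measurable]: "f \<in> borel_measurable M" and f2: "integrable M (\<lambda>x. (f x)\<^sup>2)"
    using f by (auto simp: lp_2_iff)
  obtain s where s: "\<And>i. simple_function M (s i)" and lim: "\<And>x. (\<lambda>i. s i x) \<longlonglongrightarrow> f x"
    and bound: "\<And>i x. \<bar>s i x\<bar> \<le> 2 * \<bar>f x\<bar>"
    using borel_measurable_implies_sequence_metric[of f M 0] space by (auto simp: dist_real_def)
  have [measurable]: "s i \<in> borel_measurable M" for i
    using borel_measurable_simple_function[OF s] .
  have "integrable M (\<lambda>x. (s i x)\<^sup>2)" for i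
  proof (rule Bochner_Integration.integrable_bound)
    show "integrable M (\<lambda>x. 4 * (f x)\<^sup>2)" using f2 by simp
    have "(s i x)\<^sup>2 \<le> 4 * (f x)\<^sup>2" for x
      using power_mono[OF bound[of i x] abs_ge_zero, of 2] by (simp add: power_mult_distrib)
    then show "AE x in M. norm ((s i x)\<^sup>2) \<le> norm (4 * (f x)\<^sup>2)" by simp
  qed auto
  then have "s i \<in> lp 2 M" for i by (simp add: lp_2_iff)
  then have span: "s i \<in> span_Bfin M" for i using simple_function_in_span_Bfin s space by blast
  have "(\<lambda>i. \<integral>x. (f x - s i x)\<^sup>2 \<partial>M) \<longlonglongrightarrow> (\<integral>x. 0 \<partial>M)"
  proof (rule integral_dominated_convergence)
    show "integrable M (\<lambda>x. 9 * (f x)\<^sup>2)" using f2 by simp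
    have "(\<lambda>i. (f x - s i x)\<^sup>2) \<longlonglongrightarrow> (f x - f x)\<^sup>2" for x
      by (intro tendsto_intros lim)
    then show "AE x in M. (\<lambda>i. (f x - s i x)\<^sup>2) \<longlonglongrightarrow> 0" by simp
    have "(f x - s i x)\<^sup>2 \<le> 9 * (f x)\<^sup>2" for i x
    proof -
      have "\<bar>f x - s i x\<bar> \<le> 3 * \<bar>f x\<bar>" using bound[of i x] by linarith
      from power_mono[OF this abs_ge_zero, of 2] show ?thesis by (simp add: power_mult_distrib)
    qed
    then show "AE x in M. norm ((f x - s i x)\<^sup>2) \<le> 9 * (f x)\<^sup>2" for i by simp
  qed auto
  from tendsto_real_sqrt[OF this] have "(\<lambda>i. lp_norm 2 M (\<lambda>x. f x - s i x)) \<longlonglongrightarrow> 0"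
    by (simp add: lp_norm_2)
  from order_tendstoD(2)[OF this e] obtain i where "lp_norm 2 M (\<lambda>x. f x - s i x) < e"
    by (auto simp: eventually_sequentially)
  with span show ?thesis by blast
qed

section \<open>A zero-one law for measures trivial on a generator\<close>

text \<open>
  A zero-one law: the sets which are null or have a null complement form a sigma-algebra.
\<close>

lemma trivial_measure_if_trivial_on_generator:
  assumes sets: "sets M = sigma_sets \<Omega> G" and G: "G \<subseteq> Pow \<Omega>"
    and triv: "\<And>B. B \<in> G \<Longrightarrow> emeasure M B = 0 \<or> emeasure M (\<Omega> - B) = 0"
    and A: "A \<in> sets M"
  shows "emeasure M A = 0 \<or> emeasure M (\<Omega> - A) = 0"
proof -
  have \<Omega>: "space M = \<Omega>"
    using sets_eq_imp_space_eq[of M "sigma \<Omega> G"] sets G by (simp add: space_measure_of_conv sets_measure_of)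
  have "A \<in> sigma_sets \<Omega> G" using A sets by simp
  then show ?thesis
  proof (induction rule: sigma_sets.induct)
    case (Compl a)
    moreover have "a \<subseteq> \<Omega>" using Compl.hyps sigma_sets_into_sp[OF G] by blast
    ultimately show ?case by (auto simp: double_diff)
  next
    case (Union a)
    have a: "a i \<in> sets M" for i using Union.hyps sets by auto
    show ?case
    proof (cases "\<forall>i. emeasure M (a i) = 0")
      case True
      then show ?thesis using a by (intro disjI1 emeasure_UN_eq_0) auto
    next
      case False
      then obtain i where "emeasure M (\<Omega> - a i) = 0" using Union.IH by blast
      moreover have "emeasure M (\<Omega> - (\<Union>i. a i)) \<le> emeasure M (\<Omega> - a i)"
        using a \<Omega> by (intro emeasure_mono) auto
      ultimately show ?thesis by simp
    qed
  qed (use triv in auto)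
qed

section \<open>The disintegration and the marginals of the symmetric measure\<close>

context symmetric_measure_system
begin

declare sets_mu[measurable_cong] sets_rho[measurable_cong] sets_kernel[measurable_cong]

lemma spaces [simp]: "space \<mu> = UNIV" "space \<rho> = UNIV" "space (\<kappa> x) = UNIV"
  using sets_eq_imp_space_eq[OF sets_mu] sets_eq_imp_space_eq[OF sets_rho]
    sets_eq_imp_space_eq[OF sets_kernel] by (auto simp: space_pair_measure)

lemma sets_nu [measurable_cong]: "sets (nu \<mu> \<kappa>) = sets borel"
  by (simp add: nu_def sets_mu)

lemma sets_crho [measurable_cong]: "sets (crho \<rho> \<kappa>) = sets (borel \<Otimes>\<^sub>M borel)"
  by (simp add: crho_def sets_rho)

lemma measurable_mass [measurable]: "mass \<kappa> \<in> borel_measurable borel"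
  using measurable_kernel[of UNIV] by (simp add: mass_def[abs_def] sets.top[of "borel \<Otimes>\<^sub>M borel", simplified space_pair_measure, simplified])

lemma measurable_rmass [measurable]: "rmass \<kappa> \<in> borel_measurable borel"
  unfolding rmass_def[abs_def] by measurable

lemma measurable_slice:
  assumes "f \<in> borel_measurable (borel \<Otimes>\<^sub>M borel)"
  shows "(\<lambda>y. f (x, y)) \<in> borel_measurable (\<kappa> x)"
  using assms by measurable

lemma measurable_nn_integral_kernel [measurable]:
  assumes "f \<in> borel_measurable (borel \<Otimes>\<^sub>M borel)"
  shows "(\<lambda>x. \<integral>\<^sup>+y. f (x, y) \<partial>\<kappa> x) \<in> borel_measurable borel"
  using assms
proof (induction rule: borel_measurable_induct)
  case (cong f g)
  then have "f = g" by (auto simp: space_pair_measure)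
  then show ?case using cong by simp
next
  case (set A)
  have "(\<integral>\<^sup>+y. indicator A (x, y) \<partial>\<kappa> x) = emeasure (\<kappa> x) (Pair x -` A)" for x
  proof -
    have "Pair x -` A \<in> sets (\<kappa> x)" using measurable_sets_borel[OF _ set] sets_kernel set
      by (metis sets_Pair1)
    then show ?thesis by (simp add: nn_integral_indicator[symmetric] indicator_def vimage_def del: nn_integral_indicator)
  qed
  then show ?case using measurable_kernel[OF set] by simp
next
  case (mult u c)
  have "(\<integral>\<^sup>+y. c * u (x, y) \<partial>\<kappa> x) = c * (\<integral>\<^sup>+y. u (x, y) \<partial>\<kappa> x)" for x
    using mult by (intro nn_integral_cmult measurable_slice)
  then show ?case using mult by simp
next
  case (add u v)
  have "(\<integral>\<^sup>+y. v (x, y) + u (x, y) \<partial>\<kappa> x) = (\<integral>\<^sup>+y. v (x, y) \<partial>\<kappa> x) + (\<integral>\<^sup>+y. u (x, y) \<partial>\<kappa> x)" for x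
    using add by (intro nn_integral_add measurable_slice)
  then show ?case using add by simp
next
  case (seq U)
  have "(\<integral>\<^sup>+y. (SUP i. U i) (x, y) \<partial>\<kappa> x) = (SUP i. \<integral>\<^sup>+y. U i (x, y) \<partial>\<kappa> x)" for x
    unfolding SUP_apply using seq
    by (intro nn_integral_monotone_convergence_SUP) (auto simp: incseq_def le_fun_def)
  then show ?case using seq by simp
qed

lemma measurable_measure_kernel [measurable]:
  assumes [measurable]: "A \<in> sets borel"
  shows "(\<lambda>x. measure (\<kappa> x) A) \<in> borel_measurable borel"
proof -
  have "UNIV \<times> A \<in> sets (borel \<Otimes>\<^sub>M borel)" by (intro pair_measureI) auto
  from measurable_kernel[OF this] show ?thesis
    by (simp add: measure_def vimage_def)
qed

text \<open>
  The Bochner integral is 0 where the fibre function is not integrable, so the set of these points has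
  to be seen to be measurable, too; the measures \<open>\<kappa> x\<close> may be infinite for a null set of points \<open>x\<close>.
\<close>

lemma measurable_Rt_op [measurable]:
  assumes [measurable]: "f \<in> borel_measurable (borel \<Otimes>\<^sub>M borel)"
  shows "Rt_op \<kappa> f \<in> borel_measurable borel"
proof -
  have "Rt_op \<kappa> f = (\<lambda>x. if (\<integral>\<^sup>+y. ennreal \<bar>f (x, y)\<bar> \<partial>\<kappa> x) < \<infinity>
      then enn2real (\<integral>\<^sup>+y. ennreal (f (x, y)) \<partial>\<kappa> x) - enn2real (\<integral>\<^sup>+y. ennreal (- f (x, y)) \<partial>\<kappa> x) else 0)"
    by (auto simp: Rt_op_def fun_eq_iff integrable_iff_bounded real_lebesgue_integral_def not_integrable_integral_eq)
  then show ?thesis by simp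
qed

lemma lp_rho_measurable: "f \<in> lp p \<rho> \<Longrightarrow> f \<in> borel_measurable (borel \<Otimes>\<^sub>M borel)"
  using lp_measurable measurable_cong_sets[OF sets_rho refl] by blast

lemma lp_crho_measurable:
  "f \<in> lp p (crho \<rho> \<kappa>) \<Longrightarrow> f \<in> borel_measurable (borel \<Otimes>\<^sub>M borel)"
  using lp_measurable measurable_cong_sets[OF sets_crho refl] by blast

lemma lp_mu_measurable: "f \<in> lp p \<mu> \<Longrightarrow> f \<in> borel_measurable borel"
  using lp_measurable measurable_cong_sets[OF sets_mu refl] by blast

lemma lp_nu_measurable: "f \<in> lp p (nu \<mu> \<kappa>) \<Longrightarrow> f \<in> borel_measurable borel"
  using lp_measurable measurable_cong_sets[OF sets_nu refl] by blast

lemma AE_rho_imp_AE_kernel: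
  assumes "AE z in \<rho>. P z"
  shows "AE x in \<mu>. AE y in \<kappa> x. P (x, y)"
proof -
  from assms obtain N where N: "N \<in> null_sets \<rho>" "{z. \<not> P z} \<subseteq> N"
    by (auto simp: eventually_ae_filter)
  then have [measurable]: "N \<in> sets (borel \<Otimes>\<^sub>M borel)" by (auto simp: null_sets_def sets_rho)
  have "(\<integral>\<^sup>+x. (\<integral>\<^sup>+y. indicator N (x, y) \<partial>\<kappa> x) \<partial>\<mu>) = 0"
    using N(1) disintegration[of "indicator N"] by (simp add: null_sets_def)
  then have "AE x in \<mu>. (\<integral>\<^sup>+y. indicator N (x, y) \<partial>\<kappa> x) = 0"
    by (subst (asm) nn_integral_0_iff_AE) auto
  then show ?thesis
  proof eventually_elim
    case (elim x)
    then have "AE y in \<kappa> x. indicator N (x, y) = (0::ennreal)"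
      by (subst (asm) nn_integral_0_iff_AE) auto
    then show ?case by eventually_elim (use N(2) in \<open>auto simp: indicator_def split: if_splits\<close>)
  qed
qed

lemma AE_kernel_finite:
  "AE x in \<mu>. finite_measure (\<kappa> x) \<and> mass \<kappa> x = ennreal (rmass \<kappa> x) \<and> 0 < rmass \<kappa> x"
  using mass_finite
proof eventually_elim
  case (elim x)
  then have "finite_measure (\<kappa> x)" by (intro finite_measureI) (auto simp: mass_def)
  then show ?case using elim by (auto simp: rmass_def enn2real_positive_iff)
qed

lemma not_AE_False: "\<not> (AE x in \<mu>. False)"
  using infinite_mu by (simp add: AE_iff_null null_sets_def)

lemma emeasure_rho_times:
  assumes [measurable]: "A \<in> sets borel" "B \<in> sets borel"
  shows "emeasure \<rho> (A \<times> B) = (\<integral>\<^sup>+x. indicator A x * emeasure (\<kappa> x) B \<partial>\<mu>)"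
proof -
  have "emeasure \<rho> (A \<times> B) = (\<integral>\<^sup>+z. indicator (A \<times> B) z \<partial>\<rho>)" by (simp add: sets_rho)
  also have "\<dots> = (\<integral>\<^sup>+x. (\<integral>\<^sup>+y. indicator A x * indicator B y \<partial>\<kappa> x) \<partial>\<mu>)"
    by (subst disintegration) (auto simp: indicator_times)
  also have "\<dots> = (\<integral>\<^sup>+x. indicator A x * emeasure (\<kappa> x) B \<partial>\<mu>)"
    by (simp add: nn_integral_cmult sets_kernel)
  finally show ?thesis .
qed

text \<open>
  The measure \<open>\<nu>\<close> is the first marginal of \<open>\<rho>\<close>.
\<close>

lemma emeasure_nu: 
  assumes "A \<in> sets borel"
  shows "emeasure (nu \<mu> \<kappa>) A = emeasure \<rho> (A \<times> UNIV)"
  using assms by (simp add: nu_def emeasure_density sets_mu emeasure_rho_times mass_def[symmetric] mult.commute)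

lemma Bfin_cover:
  obtains A :: "nat \<Rightarrow> 'a set" where "range A \<subseteq> Bfin \<mu>" "(\<Union>i. A i) = UNIV"
proof (rule sigma_finite_measure.sigma_finite[OF sigma_finite_mu])
  fix A :: "nat \<Rightarrow> 'a set"
  assume A: "range A \<subseteq> sets \<mu>" "(\<Union>i. A i) = space \<mu>" "\<And>i. emeasure \<mu> (A i) \<noteq> \<infinity>"
  have "range A \<subseteq> Bfin \<mu>" using A(1,3) by (auto simp: Bfin_def less_top)
  then show thesis by (rule that) (use A(2) in simp)
qed

lemma nu_Bfin: "A \<in> Bfin \<mu> \<Longrightarrow> emeasure (nu \<mu> \<kappa>) A < \<infinity>"
  using mass_locally_integrable[of A] by (simp add: nu_def emeasure_density Bfin_def)

text \<open>
  The flip preserves \<open>\<rho>\<close> on rectangles by assumption. These determine \<open>\<rho>\<close> because the space is covered by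
  countably many rectangles \<open>A\<^sub>i \<times> V\<close> of finite measure: \<open>\<rho>(A\<^sub>i \<times> V)\<close> is the integral of \<open>c\<close> over \<open>A\<^sub>i\<close>.
\<close>

lemma distr_rho_swap: "distr \<rho> (borel \<Otimes>\<^sub>M borel) (\<lambda>(x, y). (y, x)) = \<rho>"
proof -
  obtain A :: "nat \<Rightarrow> 'a set" where A: "range A \<subseteq> Bfin \<mu>" "(\<Union>i. A i) = UNIV"
    by (rule Bfin_cover)
  then have A': "A i \<in> sets borel" "emeasure (nu \<mu> \<kappa>) (A i) < \<infinity>" for i
    using nu_Bfin by (auto simp: Bfin_def sets_mu)
  let ?G = "{X \<times> Y |X Y. X \<in> sets (borel :: 'a measure) \<and> Y \<in> sets (borel :: 'a measure)}"
  have "\<rho> = distr \<rho> (borel \<Otimes>\<^sub>M borel) (\<lambda>(x, y). (y, x))"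
  proof (rule measure_eqI_generator_eq[where E="?G" and \<Omega>=UNIV and A="\<lambda>i. A i \<times> UNIV"])
    show "Int_stable ?G" using Int_stable_pair_measure_generator by blast
    show "sets \<rho> = sigma_sets UNIV ?G"
      by (simp add: sets_rho sets_pair_measure)
    show "sets (distr \<rho> (borel \<Otimes>\<^sub>M borel) (\<lambda>(x, y). (y, x))) = sigma_sets UNIV ?G"
      by (simp add: sets_pair_measure)
    show "emeasure \<rho> (A i \<times> UNIV) \<noteq> \<infinity>" for i
      using A'[of i] by (simp add: emeasure_nu)
    show "(\<Union>i. A i \<times> UNIV) = UNIV" using A(2) by auto
    have "UNIV \<in> sets (borel :: 'a measure)" by simp
    then show "range (\<lambda>i. A i \<times> UNIV) \<subseteq> ?G" using A'(1) by blast
    fix Z assume "Z \<in> ?G"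
    then obtain X Y where Z: "Z = X \<times> Y" "X \<in> sets borel" "Y \<in> sets borel" by auto
    have "(\<lambda>(x :: 'a, y :: 'a). (y, x)) -` Z \<inter> space \<rho> = Y \<times> X" unfolding Z(1) by auto
    then show "emeasure \<rho> Z = emeasure (distr \<rho> (borel \<Otimes>\<^sub>M borel) (\<lambda>(x, y). (y, x))) Z"
      using Z by (subst emeasure_distr) (auto simp: symmetric_rho)
  qed auto
  then show ?thesis ..
qed

lemma distr_rho_fst: "distr \<rho> borel fst = nu \<mu> \<kappa>"
proof (rule measure_eqI)
  fix A assume "A \<in> sets (distr \<rho> borel fst)"
  then have A: "A \<in> sets borel" by simp
  have "fst -` A \<inter> space \<rho> = A \<times> UNIV" by auto
  then show "emeasure (distr \<rho> borel fst) A = emeasure (nu \<mu> \<kappa>) A"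
    using A by (subst emeasure_distr) (auto simp: emeasure_nu)
qed (simp add: sets_nu)

lemma distr_rho_snd: "distr \<rho> borel snd = nu \<mu> \<kappa>"
proof (rule measure_eqI)
  fix A assume "A \<in> sets (distr \<rho> borel snd)"
  then have A: "A \<in> sets borel" by simp
  have "snd -` A \<inter> space \<rho> = UNIV \<times> A" by auto
  then show "emeasure (distr \<rho> borel snd) A = emeasure (nu \<mu> \<kappa>) A"
    using A by (subst emeasure_distr) (auto simp: emeasure_nu symmetric_rho)
qed (simp add: sets_nu)

lemma nn_integral_nu:
  "g \<in> borel_measurable borel \<Longrightarrow> (\<integral>\<^sup>+x. g x \<partial>nu \<mu> \<kappa>) = (\<integral>\<^sup>+x. mass \<kappa> x * g x \<partial>\<mu>)"
  unfolding nu_def by (subst nn_integral_density) auto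

lemma nn_integral_crho:
  assumes [measurable]: "g \<in> borel_measurable (borel \<Otimes>\<^sub>M borel)"
  shows "(\<integral>\<^sup>+z. g z \<partial>crho \<rho> \<kappa>) = (\<integral>\<^sup>+x. mass \<kappa> x * (\<integral>\<^sup>+y. g (x, y) \<partial>\<kappa> x) \<partial>\<mu>)"
proof -
  have "(\<integral>\<^sup>+z. g z \<partial>crho \<rho> \<kappa>) = (\<integral>\<^sup>+z. mass \<kappa> (fst z) * g z \<partial>\<rho>)"
    unfolding crho_def by (subst nn_integral_density) (auto simp: case_prod_beta)
  then show ?thesis by (simp add: disintegration nn_integral_cmult)
qed

lemma AE_nu_iff: "(AE x in nu \<mu> \<kappa>. P x) \<longleftrightarrow> (AE x in \<mu>. P x)"
proof -
  have "(AE x in nu \<mu> \<kappa>. P x) \<longleftrightarrow> (AE x in \<mu>. 0 < mass \<kappa> x \<longrightarrow> P x)"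
    unfolding nu_def by (subst AE_density) auto
  also have "\<dots> \<longleftrightarrow> (AE x in \<mu>. P x)"
    using mass_finite by (auto elim: AE_mp)
  finally show ?thesis .
qed

text \<open>
  A \<open>\<mu>\<close>-null set is \<open>\<nu>\<close>-null, and \<open>\<nu>\<close> is both marginals of \<open>\<rho>\<close>. For the second coordinate this is what makes
  \<open>R\<close> well defined on equivalence classes.
\<close>

lemma AE_rho_marginals:
  assumes "AE x in \<mu>. P x"
  shows "AE z in \<rho>. P (fst z)" "AE z in \<rho>. P (snd z)"
proof -
  have "AE x in nu \<mu> \<kappa>. P x" using assms by (simp add: AE_nu_iff)
  then have 1: "AE x in distr \<rho> borel fst. P x" and 2: "AE x in distr \<rho> borel snd. P x"
    unfolding distr_rho_fst distr_rho_snd by simp_all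
  show "AE z in \<rho>. P (fst z)" by (rule AE_distrD[OF _ 1]) simp
  show "AE z in \<rho>. P (snd z)" by (rule AE_distrD[OF _ 2]) simp
qed

lemma AE_crho_iff: "(AE z in crho \<rho> \<kappa>. P z) \<longleftrightarrow> (AE z in \<rho>. P z)"
proof -
  have "(AE z in crho \<rho> \<kappa>. P z) \<longleftrightarrow> (AE z in \<rho>. 0 < mass \<kappa> (fst z) \<longrightarrow> P z)"
    unfolding crho_def by (subst AE_density) (auto simp: case_prod_beta)
  also have "\<dots> \<longleftrightarrow> (AE z in \<rho>. P z)"
    using AE_rho_marginals(1)[OF mass_finite] by (auto elim: AE_mp)
  finally show ?thesis .
qed

section \<open>Integration over the fibres as an operator\<close>

lemma lp_1_rho_subset_Rt_dom: "lp 1 \<rho> \<subseteq> Rt_dom \<mu> \<kappa>"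
proof
  fix f assume f: "f \<in> lp 1 \<rho>"
  then have [measurable]: "f \<in> borel_measurable (borel \<Otimes>\<^sub>M borel)"
    and fin: "(\<integral>\<^sup>+z. ennreal \<bar>f z\<bar> \<partial>\<rho>) < \<infinity>"
    by (auto simp: lp_1_iff integrable_iff_bounded)
  have "AE x in \<mu>. (\<integral>\<^sup>+y. ennreal \<bar>f (x, y)\<bar> \<partial>\<kappa> x) \<noteq> \<infinity>"
    using fin by (intro nn_integral_PInf_AE) (auto simp: disintegration)
  then have "AE x in \<mu>. integrable (\<kappa> x) (slice x f)"
    by eventually_elim (auto simp: integrable_iff_bounded slice_def less_top)
  then show "f \<in> Rt_dom \<mu> \<kappa>" by (simp add: Rt_dom_def)
qed

text \<open>
  Fubini's theorem for the disintegration: the formula for nonnegative functions is applied to the positive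
  and the negative part, whose fibre integrals are finite almost everywhere.
\<close>

lemma Rt_op_integral:
  assumes f: "f \<in> lp 1 \<rho>"
  shows "Rt_op \<kappa> f \<in> lp 1 \<mu>" "(\<integral>z. f z \<partial>\<rho>) = (\<integral>x. Rt_op \<kappa> f x \<partial>\<mu>)"
proof -
  from f have [measurable]: "f \<in> borel_measurable (borel \<Otimes>\<^sub>M borel)" and int: "integrable \<rho> f"
    by (auto simp: lp_1_iff integrable_iff_bounded)
  define P where "P x = (\<integral>\<^sup>+y. ennreal (f (x, y)) \<partial>\<kappa> x)" for x
  define N where "N x = (\<integral>\<^sup>+y. ennreal (- f (x, y)) \<partial>\<kappa> x)" for x
  have [measurable]: "P \<in> borel_measurable borel" "N \<in> borel_measurable borel"
    unfolding P_def[abs_def] N_def[abs_def] by measurable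
  have P: "(\<integral>\<^sup>+x. P x \<partial>\<mu>) = (\<integral>\<^sup>+z. ennreal (f z) \<partial>\<rho>)"
    and N: "(\<integral>\<^sup>+x. N x \<partial>\<mu>) = (\<integral>\<^sup>+z. ennreal (- f z) \<partial>\<rho>)"
    by (simp_all add: P_def N_def disintegration)
  have fin: "(\<integral>\<^sup>+z. ennreal (f z) \<partial>\<rho>) \<noteq> \<infinity>" "(\<integral>\<^sup>+z. ennreal (- f z) \<partial>\<rho>) \<noteq> \<infinity>"
    using int by (auto simp: real_integrable_def)
  have aeP: "AE x in \<mu>. P x \<noteq> \<infinity>" and aeN: "AE x in \<mu>. N x \<noteq> \<infinity>"
    using nn_integral_PInf_AE[of P \<mu>] nn_integral_PInf_AE[of N \<mu>] fin P N by simp_all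
  have intP: "has_bochner_integral \<mu> (\<lambda>x. enn2real (P x)) (enn2real (\<integral>\<^sup>+z. ennreal (f z) \<partial>\<rho>))"
  proof (rule has_bochner_integral_nn_integral)
    have "(\<integral>\<^sup>+x. ennreal (enn2real (P x)) \<partial>\<mu>) = (\<integral>\<^sup>+x. P x \<partial>\<mu>)"
      by (rule nn_integral_cong_AE) (use aeP in eventually_elim, auto simp: less_top)
    then show "(\<integral>\<^sup>+x. ennreal (enn2real (P x)) \<partial>\<mu>) = ennreal (enn2real (\<integral>\<^sup>+z. ennreal (f z) \<partial>\<rho>))"
      using fin by (simp add: P less_top)
  qed auto
  have intN: "has_bochner_integral \<mu> (\<lambda>x. enn2real (N x)) (enn2real (\<integral>\<^sup>+z. ennreal (- f z) \<partial>\<rho>))"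
  proof (rule has_bochner_integral_nn_integral)
    have "(\<integral>\<^sup>+x. ennreal (enn2real (N x)) \<partial>\<mu>) = (\<integral>\<^sup>+x. N x \<partial>\<mu>)"
      by (rule nn_integral_cong_AE) (use aeN in eventually_elim, auto simp: less_top)
    then show "(\<integral>\<^sup>+x. ennreal (enn2real (N x)) \<partial>\<mu>) = ennreal (enn2real (\<integral>\<^sup>+z. ennreal (- f z) \<partial>\<rho>))"
      using fin by (simp add: N less_top)
  qed auto
  have "has_bochner_integral \<mu> (\<lambda>x. enn2real (P x) - enn2real (N x)) (\<integral>z. f z \<partial>\<rho>)"
    using has_bochner_integral_diff[OF intP intN] int by (simp add: real_lebesgue_integral_def)
  moreover have "AE x in \<mu>. enn2real (P x) - enn2real (N x) = Rt_op \<kappa> f x"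
  proof -
    have "AE x in \<mu>. integrable (\<kappa> x) (slice x f)"
      using lp_1_rho_subset_Rt_dom f by (auto simp: Rt_dom_def)
    then show ?thesis
      by eventually_elim (simp add: Rt_op_def P_def N_def real_lebesgue_integral_def slice_def)
  qed
  ultimately have "has_bochner_integral \<mu> (Rt_op \<kappa> f) (\<integral>z. f z \<partial>\<rho>)"
    by (elim has_bochner_integralI_AE) measurable
  then show "Rt_op \<kappa> f \<in> lp 1 \<mu>" "(\<integral>z. f z \<partial>\<rho>) = (\<integral>x. Rt_op \<kappa> f x \<partial>\<mu>)"
    by (auto simp: lp_1_iff has_bochner_integral_iff)
qed

lemma Rt_op_norm_1_le:
  assumes f: "f \<in> lp 1 \<rho>"
  shows "lp_norm 1 \<mu> (Rt_op \<kappa> f) \<le> lp_norm 1 \<rho> f"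
proof -
  have af: "(\<lambda>z. \<bar>f z\<bar>) \<in> lp 1 \<rho>" using f by (simp add: lp_1_iff)
  have "(\<integral>x. \<bar>Rt_op \<kappa> f x\<bar> \<partial>\<mu>) \<le> (\<integral>x. Rt_op \<kappa> (\<lambda>z. \<bar>f z\<bar>) x \<partial>\<mu>)"
    using Rt_op_integral(1)[OF f] Rt_op_integral(1)[OF af]
    by (intro integral_mono) (auto simp: lp_1_iff, simp add: Rt_op_def)
  also have "\<dots> = (\<integral>z. \<bar>f z\<bar> \<partial>\<rho>)" using Rt_op_integral(2)[OF af] by simp
  finally show ?thesis by (simp add: lp_norm_1)
qed

text \<open>
  Covers \<open>L\<^sup>1(\<rho>)\<close>, \<open>L\<^sup>2(\<rho>)\<close> and \<open>L\<^sup>2(c\<rho>)\<close> at once: only the null sets of the measure matter.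
\<close>

lemma ae_linear_on_Rt_op:
  assumes p: "p \<in> {1, 2}" and sets: "sets M = sets (borel \<Otimes>\<^sub>M borel)"
    and dom: "lp p M \<subseteq> Rt_dom \<mu> \<kappa>"
    and ae: "\<And>P. (AE z in M. P z) \<Longrightarrow> (AE z in \<rho>. P z)"
  shows "ae_linear_on (lp p M) M \<mu> (Rt_op \<kappa>)"
  unfolding ae_linear_on_def
proof (intro conjI ballI allI impI)
  have meas: "f \<in> borel_measurable (borel \<Otimes>\<^sub>M borel)" if "f \<in> lp p M" for f
    using lp_measurable[OF that] measurable_cong_sets[OF sets refl] by blast
  fix f g assume fg: "f \<in> lp p M" "g \<in> lp p M"
  note [measurable] = fg[THEN meas]
  show "AE x in \<mu>. Rt_op \<kappa> f x = Rt_op \<kappa> g x" if "AE z in M. f z = g z"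
    using AE_rho_imp_AE_kernel[OF ae[OF that]]
    by eventually_elim (auto simp: Rt_op_def intro!: integral_cong_AE)
  fix a b :: real
  show "(\<lambda>x. a * f x + b * g x) \<in> lp p M" using lp_linear_combination p fg by blast
  have "AE x in \<mu>. integrable (\<kappa> x) (slice x f)" "AE x in \<mu>. integrable (\<kappa> x) (slice x g)"
    using dom fg by (auto simp: Rt_dom_def)
  then show "AE x in \<mu>. Rt_op \<kappa> (\<lambda>x. a * f x + b * g x) x = a * Rt_op \<kappa> f x + b * Rt_op \<kappa> g x"
    by eventually_elim (auto simp: Rt_op_def slice_def)
qed

lemma lp_operator_1_Rt_op: "lp_operator 1 \<rho> \<mu> (Rt_op \<kappa>)"
  unfolding lp_operator_def
proof
  show "ae_linear_on (lp 1 \<rho>) \<rho> \<mu> (Rt_op \<kappa>)"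
    by (rule ae_linear_on_Rt_op) (simp_all add: sets_rho lp_1_rho_subset_Rt_dom)
qed (use Rt_op_integral(1) in blast)

lemma Rt_op_fst_mult: "Rt_op \<kappa> (\<lambda>z. g (fst z) * f z) = (\<lambda>x. g x * Rt_op \<kappa> f x)"
  by (simp add: Rt_op_def fun_eq_iff)

lemma linf_mult_lp_1:
  assumes g: "g \<in> linf \<mu>" and f: "f \<in> lp 1 \<rho>"
  shows "(\<lambda>z. g (fst z) * f z) \<in> lp 1 \<rho>"
proof -
  note [measurable] = lp_rho_measurable[OF f]
  have "g \<in> borel_measurable \<mu>" using g by (simp add: linf_def)
  then have [measurable]: "g \<in> borel_measurable borel" by simp
  have "emeasure \<mu> (space \<mu>) \<noteq> 0" using infinite_mu by simp
  note bound = AE_rho_marginals(1)[OF linf_AE_bound(1)[OF g this]]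
  have i: "integrable \<rho> (\<lambda>z. linf_norm \<mu> g * f z)" using f by (simp add: lp_1_iff)
  have "integrable \<rho> (\<lambda>z. g (fst z) * f z)"
  proof (rule Bochner_Integration.integrable_bound[OF i])
    show "AE z in \<rho>. norm (g (fst z) * f z) \<le> norm (linf_norm \<mu> g * f z)"
      using bound by eventually_elim (auto simp: abs_mult intro!: mult_right_mono)
  qed measurable
  then show ?thesis by (simp add: lp_1_iff)
qed

text \<open>
  The Cauchy-Schwarz inequality in \<open>L\<^sup>2(\<rho>\<^sub>x)\<close> against the constant 1, whose square has integral \<open>c(x)\<close>.
\<close>

lemma square_Rt_op_le:
  assumes [measurable]: "f \<in> borel_measurable (borel \<Otimes>\<^sub>M borel)"
  shows "AE x in \<mu>. ennreal ((Rt_op \<kappa> f x)\<^sup>2) \<le> mass \<kappa> x * (\<integral>\<^sup>+y. ennreal ((f (x, y))\<^sup>2) \<partial>\<kappa> x)"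
  using AE_kernel_finite
proof eventually_elim
  case (elim x)
  then interpret finite_measure "\<kappa> x" by simp
  have "ennreal ((Rt_op \<kappa> f x)\<^sup>2) = (ennreal \<bar>\<integral>y. f (x, y) \<partial>\<kappa> x\<bar>)\<^sup>2"
    by (simp add: Rt_op_def ennreal_power)
  also have "\<dots> \<le> (\<integral>\<^sup>+y. ennreal \<bar>f (x, y)\<bar> \<partial>\<kappa> x)\<^sup>2"
    by (intro power_mono ennreal_abs_integral_le) simp
  also have "\<dots> \<le> mass \<kappa> x * (\<integral>\<^sup>+y. ennreal ((f (x, y))\<^sup>2) \<partial>\<kappa> x)"
    using square_nn_integral_abs_le[of "\<lambda>y. f (x, y)"] by (simp add: mass_def)
  finally show ?case .
qed

text \<open>
  Square integrable functions are integrable on finite measure spaces, and almost every \<open>\<rho>\<^sub>x\<close> is finite.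
\<close>

lemma Rt_dom_if_square_integrable:
  assumes [measurable]: "f \<in> borel_measurable (borel \<Otimes>\<^sub>M borel)"
    and "AE x in \<mu>. (\<integral>\<^sup>+y. ennreal ((f (x, y))\<^sup>2) \<partial>\<kappa> x) < \<infinity>"
  shows "f \<in> Rt_dom \<mu> \<kappa>"
proof -
  have "AE x in \<mu>. integrable (\<kappa> x) (slice x f)"
    using assms(2) AE_kernel_finite
  proof eventually_elim
    case (elim x)
    then interpret finite_measure "\<kappa> x" by simp
    have "integrable (\<kappa> x) (\<lambda>y. (f (x, y))\<^sup>2)" using elim by (auto simp: integrable_iff_bounded)
    then show ?case
      unfolding slice_def by (rule square_integrable_imp_integrable[rotated]) (simp add: measurable_slice)
  qed
  then show ?thesis by (simp add: Rt_dom_def)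
qed

lemma AE_square_integrable_rho:
  assumes f: "f \<in> lp 2 \<rho>"
  shows "AE x in \<mu>. (\<integral>\<^sup>+y. ennreal ((f (x, y))\<^sup>2) \<partial>\<kappa> x) < \<infinity>"
proof -
  note [measurable] = lp_rho_measurable[OF f]
  have "(\<integral>\<^sup>+x. (\<integral>\<^sup>+y. ennreal ((f (x, y))\<^sup>2) \<partial>\<kappa> x) \<partial>\<mu>) < \<infinity>"
    using f by (simp add: lp_2_iff_nn_integral disintegration)
  then have "AE x in \<mu>. (\<integral>\<^sup>+y. ennreal ((f (x, y))\<^sup>2) \<partial>\<kappa> x) \<noteq> \<infinity>"
    by (intro nn_integral_PInf_AE) auto
  then show ?thesis by (simp add: less_top)
qed

lemma AE_square_integrable_crho:
  assumes f: "f \<in> lp 2 (crho \<rho> \<kappa>)"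
  shows "AE x in \<mu>. (\<integral>\<^sup>+y. ennreal ((f (x, y))\<^sup>2) \<partial>\<kappa> x) < \<infinity>"
proof -
  note [measurable] = lp_crho_measurable[OF f]
  have "(\<integral>\<^sup>+x. mass \<kappa> x * (\<integral>\<^sup>+y. ennreal ((f (x, y))\<^sup>2) \<partial>\<kappa> x) \<partial>\<mu>) < \<infinity>"
    using f by (simp add: lp_2_iff_nn_integral nn_integral_crho)
  then have "AE x in \<mu>. mass \<kappa> x * (\<integral>\<^sup>+y. ennreal ((f (x, y))\<^sup>2) \<partial>\<kappa> x) \<noteq> \<infinity>"
    by (intro nn_integral_PInf_AE) auto
  then show ?thesis
    using mass_finite by eventually_elim (auto simp: ennreal_mult_eq_top_iff less_top)
qed

lemma lp_2_rho_subset_Rt_dom: "lp 2 \<rho> \<subseteq> Rt_dom \<mu> \<kappa>"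
proof
  fix f assume f: "f \<in> lp 2 \<rho>"
  show "f \<in> Rt_dom \<mu> \<kappa>"
    using lp_rho_measurable[OF f] AE_square_integrable_rho[OF f] by (rule Rt_dom_if_square_integrable)
qed

lemma lp_2_crho_subset_Rt_dom: "lp 2 (crho \<rho> \<kappa>) \<subseteq> Rt_dom \<mu> \<kappa>"
proof
  fix f assume f: "f \<in> lp 2 (crho \<rho> \<kappa>)"
  show "f \<in> Rt_dom \<mu> \<kappa>"
    using lp_crho_measurable[OF f] AE_square_integrable_crho[OF f] by (rule Rt_dom_if_square_integrable)
qed

lemma Rt_op_crho_bound:
  assumes f: "f \<in> lp 2 (crho \<rho> \<kappa>)"
  shows "Rt_op \<kappa> f \<in> lp 2 \<mu>" "lp_norm 2 \<mu> (Rt_op \<kappa> f) \<le> 1 * lp_norm 2 (crho \<rho> \<kappa>) f"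
proof -
  note [measurable] = lp_crho_measurable[OF f]
  have "(\<integral>\<^sup>+x. ennreal ((Rt_op \<kappa> f x)\<^sup>2) \<partial>\<mu>) \<le> ennreal 1 * (\<integral>\<^sup>+z. ennreal ((f z)\<^sup>2) \<partial>crho \<rho> \<kappa>)"
    using nn_integral_mono_AE[OF square_Rt_op_le[of f]] by (simp add: nn_integral_crho)
  from lp_2_bound[OF f _ _ this]
  show "Rt_op \<kappa> f \<in> lp 2 \<mu>" "lp_norm 2 \<mu> (Rt_op \<kappa> f) \<le> 1 * lp_norm 2 (crho \<rho> \<kappa>) f" by simp_all
qed

lemma lp_operator_2_crho_Rt_op: "lp_operator 2 (crho \<rho> \<kappa>) \<mu> (Rt_op \<kappa>)"
  unfolding lp_operator_def
proof
  show "ae_linear_on (lp 2 (crho \<rho> \<kappa>)) (crho \<rho> \<kappa>) \<mu> (Rt_op \<kappa>)"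
    by (rule ae_linear_on_Rt_op) (simp_all add: sets_crho lp_2_crho_subset_Rt_dom AE_crho_iff)
qed (use Rt_op_crho_bound(1) in blast)

lemma lp_operator_2_rho_Rt_op:
  assumes "\<And>f. f \<in> lp 2 \<rho> \<Longrightarrow> Rt_op \<kappa> f \<in> lp 2 \<mu>"
  shows "lp_operator 2 \<rho> \<mu> (Rt_op \<kappa>)"
  unfolding lp_operator_def
proof
  show "ae_linear_on (lp 2 \<rho>) \<rho> \<mu> (Rt_op \<kappa>)"
    by (rule ae_linear_on_Rt_op) (simp_all add: sets_rho lp_2_rho_subset_Rt_dom)
qed (use assms in blast)

lemma rmass_AE_bound:
  assumes "rmass \<kappa> \<in> linf \<mu>"
  shows "AE x in \<mu>. mass \<kappa> x \<le> ennreal (linf_norm \<mu> (rmass \<kappa>))" "0 \<le> linf_norm \<mu> (rmass \<kappa>)"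
proof -
  have nz: "emeasure \<mu> (space \<mu>) \<noteq> 0" using infinite_mu by simp
  show "0 \<le> linf_norm \<mu> (rmass \<kappa>)" using linf_AE_bound[OF assms nz] by simp
  show "AE x in \<mu>. mass \<kappa> x \<le> ennreal (linf_norm \<mu> (rmass \<kappa>))"
    using linf_AE_bound(1)[OF assms nz] AE_kernel_finite
    by eventually_elim (auto intro!: ennreal_leI)
qed

lemma Rt_op_rho_bound:
  assumes c: "rmass \<kappa> \<in> linf \<mu>" and f: "f \<in> lp 2 \<rho>"
  shows "Rt_op \<kappa> f \<in> lp 2 \<mu>"
    "lp_norm 2 \<mu> (Rt_op \<kappa> f) \<le> sqrt (linf_norm \<mu> (rmass \<kappa>)) * lp_norm 2 \<rho> f"
proof -
  let ?C = "linf_norm \<mu> (rmass \<kappa>)"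
  note [measurable] = lp_rho_measurable[OF f]
  have "AE x in \<mu>. ennreal ((Rt_op \<kappa> f x)\<^sup>2) \<le> ennreal ?C * (\<integral>\<^sup>+y. ennreal ((f (x, y))\<^sup>2) \<partial>\<kappa> x)"
    using square_Rt_op_le[OF lp_rho_measurable[OF f]] rmass_AE_bound(1)[OF c]
    by eventually_elim (meson order_trans mult_right_mono zero_le)
  then have "(\<integral>\<^sup>+x. ennreal ((Rt_op \<kappa> f x)\<^sup>2) \<partial>\<mu>)
      \<le> (\<integral>\<^sup>+x. ennreal ?C * (\<integral>\<^sup>+y. ennreal ((f (x, y))\<^sup>2) \<partial>\<kappa> x) \<partial>\<mu>)"
    by (rule nn_integral_mono_AE)
  also have "\<dots> = ennreal ?C * (\<integral>\<^sup>+z. ennreal ((f z)\<^sup>2) \<partial>\<rho>)"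
    by (simp add: disintegration nn_integral_cmult)
  finally have le: "(\<integral>\<^sup>+x. ennreal ((Rt_op \<kappa> f x)\<^sup>2) \<partial>\<mu>) \<le> ennreal ?C * (\<integral>\<^sup>+z. ennreal ((f z)\<^sup>2) \<partial>\<rho>)" .
  show "Rt_op \<kappa> f \<in> lp 2 \<mu>" "lp_norm 2 \<mu> (Rt_op \<kappa> f) \<le> sqrt ?C * lp_norm 2 \<rho> f"
    using lp_2_bound[OF f _ rmass_AE_bound(2)[OF c] le] by simp_all
qed

text \<open>
  The operator norm is at most the square root of \<open>\<parallel>c\<parallel>\<^sub>\<infinity>\<close>, which lies below \<open>\<parallel>c\<parallel>\<^sub>\<infinity>\<close> only from 1 onwards.
\<close>

lemma Rt_op_rho_bounded:
  assumes c: "rmass \<kappa> \<in> linf \<mu>"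
  shows "bounded_lp_operator 2 \<rho> \<mu> (Rt_op \<kappa>)"
    "(lp_opnorm 2 \<rho> \<mu> (Rt_op \<kappa>))\<^sup>2 \<le> linf_norm \<mu> (rmass \<kappa>)"
    "1 \<le> linf_norm \<mu> (rmass \<kappa>) \<Longrightarrow> lp_opnorm 2 \<rho> \<mu> (Rt_op \<kappa>) \<le> linf_norm \<mu> (rmass \<kappa>)"
proof -
  let ?C = "linf_norm \<mu> (rmass \<kappa>)" and ?N = "lp_opnorm 2 \<rho> \<mu> (Rt_op \<kappa>)"
  have C: "0 \<le> ?C" using rmass_AE_bound(2)[OF c] .
  have op: "lp_operator 2 \<rho> \<mu> (Rt_op \<kappa>)"
    using Rt_op_rho_bound(1)[OF c] by (rule lp_operator_2_rho_Rt_op)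
  show bdd: "bounded_lp_operator 2 \<rho> \<mu> (Rt_op \<kappa>)"
    using bounded_lp_operatorI(1)[OF op _ Rt_op_rho_bound(2)[OF c]] C by simp
  have N: "?N \<le> sqrt ?C"
    using bounded_lp_operatorI(2)[OF op _ Rt_op_rho_bound(2)[OF c]] C by simp
  show sq: "?N\<^sup>2 \<le> ?C"
    using power_mono[OF N lp_opnorm_nonneg[OF bdd], of 2] C by simp
  assume "1 \<le> ?C"
  then have "?C * 1 \<le> ?C * ?C" using C by (intro mult_left_mono)
  then have "?N\<^sup>2 \<le> ?C\<^sup>2" using sq by (simp add: power2_eq_square)
  then show "?N \<le> ?C" using C by (rule power2_le_imp_le)
qed

section \<open>Surjectivity and failure of injectivity\<close>

lemma rmass_eq_measure: "rmass \<kappa> x = measure (\<kappa> x) UNIV"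
  by (simp add: rmass_def mass_def measure_def)

lemma Rt_op_fst_times_indicator:
  "B \<in> sets borel \<Longrightarrow> Rt_op \<kappa> (\<lambda>z. g (fst z) * indicator B (snd z)) x = g x * measure (\<kappa> x) B"
  by (simp add: Rt_op_def)

lemma fst_times_indicator_in_lp_1:
  assumes [measurable]: "g \<in> borel_measurable borel" "B \<in> sets borel"
    and int: "integrable \<mu> (\<lambda>x. g x * measure (\<kappa> x) B)"
  shows "(\<lambda>z. g (fst z) * indicator B (snd z)) \<in> lp 1 \<rho>"
proof -
  have "(\<integral>\<^sup>+z. ennreal \<bar>g (fst z) * indicator B (snd z)\<bar> \<partial>\<rho>)
      = (\<integral>\<^sup>+x. (\<integral>\<^sup>+y. ennreal \<bar>g x\<bar> * indicator B y \<partial>\<kappa> x) \<partial>\<mu>)"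
    by (subst disintegration) (auto simp: abs_mult ennreal_mult ennreal_indicator)
  also have "\<dots> = (\<integral>\<^sup>+x. ennreal \<bar>g x * measure (\<kappa> x) B\<bar> \<partial>\<mu>)"
  proof (rule nn_integral_cong_AE)
    show "AE x in \<mu>. (\<integral>\<^sup>+y. ennreal \<bar>g x\<bar> * indicator B y \<partial>\<kappa> x) = ennreal \<bar>g x * measure (\<kappa> x) B\<bar>"
      using AE_kernel_finite
    proof eventually_elim
      case (elim x)
      then interpret finite_measure "\<kappa> x" by simp
      show ?case by (simp add: nn_integral_cmult sets_kernel emeasure_eq_measure abs_mult ennreal_mult)
    qed
  qed
  also have "\<dots> < \<infinity>" using int by (simp add: integrable_iff_bounded)
  finally show ?thesis by (simp add: lp_1_iff integrable_iff_bounded)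
qed

text \<open>
  The preimage of \<open>h\<close> is \<open>h(x)/c(x)\<close>, constant on each fibre.
\<close>

lemma lp_onto_Rt_op: "lp_onto 1 \<rho> \<mu> (Rt_op \<kappa>)"
  unfolding lp_onto_def
proof
  fix h assume h: "h \<in> lp 1 \<mu>"
  note [measurable] = lp_mu_measurable[OF h]
  let ?f = "\<lambda>z. h (fst z) / rmass \<kappa> (fst z) * indicator UNIV (snd z)"
  have ae: "AE x in \<mu>. h x / rmass \<kappa> x * measure (\<kappa> x) UNIV = h x"
    using AE_kernel_finite by eventually_elim (auto simp: rmass_eq_measure)
  have "integrable \<mu> (\<lambda>x. h x / rmass \<kappa> x * measure (\<kappa> x) UNIV)"
    using h ae by (subst integrable_cong_AE[where g=h]) (auto simp: lp_1_iff)
  then have "?f \<in> lp 1 \<rho>"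
    using fst_times_indicator_in_lp_1[of "\<lambda>x. h x / rmass \<kappa> x" UNIV] by simp
  moreover have "AE x in \<mu>. Rt_op \<kappa> ?f x = h x"
    using ae Rt_op_fst_times_indicator[of UNIV "\<lambda>x. h x / rmass \<kappa> x"] by simp
  ultimately show "\<exists>f\<in>lp 1 \<rho>. AE x in \<mu>. Rt_op \<kappa> f x = h x" by blast
qed

text \<open>
  If no Borel set splits \<open>\<rho>\<^sub>x\<close> for a non-null set of points \<open>x\<close>, then for almost every \<open>x\<close> all members of a
  countable base are trivial for \<open>\<rho>\<^sub>x\<close> simultaneously. By the zero-one law all Borel sets are then
  trivial, so no part of \<open>E\<^sub>x\<close> has intermediate measure.
\<close>

lemma ex_kernel_splitting_set:
  "\<exists>A\<in>sets borel. \<not> (AE x in \<mu>. emeasure (\<kappa> x) A = 0 \<or> emeasure (\<kappa> x) (- A) = 0)"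
proof (rule ccontr)
  assume contra: "\<not> ?thesis"
  obtain G :: "'a set set" where G: "countable G" "topological_basis G"
    using ex_countable_basis by blast
  have borel: "sets (borel :: 'a measure) = sigma_sets UNIV G"
    by (simp add: borel_eq_countable_basis[OF G])
  then have "AE x in \<mu>. emeasure (\<kappa> x) B = 0 \<or> emeasure (\<kappa> x) (- B) = 0" if "B \<in> G" for B
    using contra that by auto
  then have "AE x in \<mu>. \<forall>B\<in>G. emeasure (\<kappa> x) B = 0 \<or> emeasure (\<kappa> x) (- B) = 0"
    using G(1) by (simp add: AE_ball_countable)
  then have "AE x in \<mu>. False"
    using supported_kernel irreducible mass_finite
  proof eventually_elim
    case (elim x)
    let ?E = "E `` {x}"
    have [measurable]: "?E \<in> sets borel"
      using sets_Pair1[OF borel_E, of x] by (simp add: Image_singleton vimage_def)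
    have triv: "emeasure (\<kappa> x) B = 0 \<or> emeasure (\<kappa> x) (- B) = 0" if "B \<in> sets borel" for B
      using trivial_measure_if_trivial_on_generator[of "\<kappa> x" UNIV G B] elim(1) that
      by (simp add: sets_kernel borel Compl_eq_Diff_UNIV)
    have restr: "emeasure (restrict_space (\<kappa> x) ?E) B = emeasure (\<kappa> x) B" if "B \<subseteq> ?E" for B
      using that by (intro emeasure_restrict_space) (auto simp: sets_kernel)
    have split: "mass \<kappa> x \<le> emeasure (\<kappa> x) B + emeasure (\<kappa> x) (- B)" if "B \<in> sets borel" for B
      using emeasure_subadditive[of B "\<kappa> x" "- B"] that by (simp add: mass_def sets_kernel Compl_eq_Diff_UNIV)
    have "0 < emeasure (\<kappa> x) ?E" using split[of ?E] elim by (auto simp: gr_zeroI)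
    moreover have "?E \<in> sets (restrict_space (\<kappa> x) ?E)" by (auto simp: sets_restrict_space_iff sets_kernel)
    ultimately obtain B where B: "B \<in> sets (restrict_space (\<kappa> x) ?E)" "B \<subseteq> ?E"
        "0 < emeasure (\<kappa> x) B" "emeasure (\<kappa> x) B < emeasure (\<kappa> x) ?E"
      using elim(3) restr unfolding nonatomic_def by (metis order_refl)
    then have "B \<in> sets borel" by (auto simp: sets_restrict_space_iff sets_kernel)
    with triv B(3) have "emeasure (\<kappa> x) (- B) = 0" by fastforce
    with split[OF \<open>B \<in> sets borel\<close>] have "mass \<kappa> x \<le> emeasure (\<kappa> x) B" by simp
    moreover have "emeasure (\<kappa> x) ?E \<le> mass \<kappa> x"
      unfolding mass_def by (intro emeasure_mono) (auto simp: sets_kernel)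
    ultimately show False using B(4) by simp
  qed
  with not_AE_False show False by simp
qed

lemma ex_Bfin_subset:
  assumes "S \<in> sets borel" "emeasure \<mu> S \<noteq> 0"
  obtains X where "X \<in> Bfin \<mu>" "X \<subseteq> S" "emeasure \<mu> X \<noteq> 0"
proof -
  obtain A :: "nat \<Rightarrow> 'a set" where A: "range A \<subseteq> Bfin \<mu>" "(\<Union>i. A i) = UNIV"
    by (rule Bfin_cover)
  have X: "S \<inter> A i \<in> Bfin \<mu>" for i
  proof -
    have "A i \<in> sets \<mu>" "emeasure \<mu> (A i) < \<infinity>" using A by (auto simp: Bfin_def)
    moreover have "emeasure \<mu> (S \<inter> A i) \<le> emeasure \<mu> (A i)"
      using \<open>A i \<in> sets \<mu>\<close> by (intro emeasure_mono) auto
    ultimately show ?thesis using assms(1) by (auto simp: Bfin_def sets_mu)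
  qed
  have "\<exists>i. emeasure \<mu> (S \<inter> A i) \<noteq> 0"
  proof (rule ccontr)
    assume "\<not> ?thesis"
    then have "emeasure \<mu> (\<Union>i. S \<inter> A i) = 0"
      using X by (intro emeasure_UN_eq_0) (auto simp: Bfin_def)
    moreover have "(\<Union>i. S \<inter> A i) = S" using A(2) by auto
    ultimately show False using assms by simp
  qed
  then show thesis using X that by blast
qed

text \<open>
  Take a set \<open>A\<close> splitting \<open>\<rho>\<^sub>x\<close> for all \<open>x\<close> in a set \<open>X\<close> of positive finite measure. Spreading the unit mass
  uniformly over \<open>A\<close>, or over its complement, in each fibre over \<open>X\<close> gives two functions with the same fibre
  integral \<open>1\<^sub>X\<close> but disjoint supports.
\<close>

lemma not_lp_one_to_one_Rt_op: "\<not> lp_one_to_one 1 \<rho> \<mu> (Rt_op \<kappa>)"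
proof
  assume inj: "lp_one_to_one 1 \<rho> \<mu> (Rt_op \<kappa>)"
  obtain A where [measurable]: "A \<in> sets borel"
    and A: "\<not> (AE x in \<mu>. emeasure (\<kappa> x) A = 0 \<or> emeasure (\<kappa> x) (- A) = 0)"
    using ex_kernel_splitting_set by blast
  define S where "S = {x. 0 < measure (\<kappa> x) A \<and> 0 < measure (\<kappa> x) (- A)}"
  have [measurable]: "- A \<in> sets borel" by (simp add: Compl_eq_Diff_UNIV)
  have S [measurable]: "S \<in> sets borel" unfolding S_def by measurable
  have "emeasure \<mu> S \<noteq> 0"
  proof
    assume "emeasure \<mu> S = 0"
    then have "AE x in \<mu>. x \<notin> S" using S by (intro AE_not_in) (auto simp: null_sets_def sets_mu)
    then have "AE x in \<mu>. emeasure (\<kappa> x) A = 0 \<or> emeasure (\<kappa> x) (- A) = 0"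
      using AE_kernel_finite
    proof eventually_elim
      case (elim x)
      then interpret finite_measure "\<kappa> x" by simp
      show ?case using elim by (auto simp: S_def emeasure_eq_measure zero_less_measure_iff)
    qed
    with A show False ..
  qed
  then obtain X where X: "X \<in> Bfin \<mu>" "X \<subseteq> S" "emeasure \<mu> X \<noteq> 0"
    using ex_Bfin_subset S by metis
  have [measurable]: "X \<in> sets borel" using X by (simp add: Bfin_def sets_mu)
  define w where "w B x = indicator X x / measure (\<kappa> x) B" for B x
  define f where "f B = (\<lambda>z. w B (fst z) * indicator B (snd z))" for B
  have Rt: "Rt_op \<kappa> (f B) = indicator X" and f: "f B \<in> lp 1 \<rho>" if B: "B \<in> {A, - A}" for B
  proof -
    have [measurable]: "B \<in> sets borel" using B by auto
    have eq: "w B x * measure (\<kappa> x) B = indicator X x" for x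
      using B X(2) by (auto simp: w_def S_def split: split_indicator)
    show "Rt_op \<kappa> (f B) = indicator X"
      by (simp add: f_def fun_eq_iff Rt_op_fst_times_indicator eq)
    have "integrable \<mu> (indicator X :: 'a \<Rightarrow> real)" using X by (simp add: Bfin_def)
    moreover have "w B \<in> borel_measurable borel" unfolding w_def by measurable
    ultimately show "f B \<in> lp 1 \<rho>"
      unfolding f_def by (intro fst_times_indicator_in_lp_1) (simp_all add: eq)
  qed
  \<comment> \<open>Almost everywhere equal functions with disjoint supports vanish almost everywhere.\<close>
  have "AE z in \<rho>. f A z = f (- A) z"
    using inj f Rt unfolding lp_one_to_one_def by auto
  then have "AE z in \<rho>. f A z = 0"
    by eventually_elim (auto simp: f_def split: split_indicator_asm)
  then have "(\<integral>z. f A z \<partial>\<rho>) = 0" by (simp add: integral_eq_zero_AE)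
  moreover have "(\<integral>z. f A z \<partial>\<rho>) = measure \<mu> X"
    using Rt_op_integral(2)[OF f[of A]] Rt[of A] X by (simp add: Bfin_def)
  moreover have "measure \<mu> X \<noteq> 0"
    using X by (auto simp: measure_def enn2real_eq_0_iff Bfin_def)
  ultimately show False by simp
qed

section \<open>The lifting along the first projection and its adjoint\<close>

lemma U_op_lp_iff: "f \<in> borel_measurable borel \<Longrightarrow> U_op f \<in> lp p \<rho> \<longleftrightarrow> f \<in> lp p (nu \<mu> \<kappa>)"
  using lp_distr_iff[OF _ distr_rho_fst, of f p] by (simp add: U_op_def)

text \<open>
  Stated for \<open>\<mu>\<close> along with \<open>\<nu>\<close>, since the adjoint relation regards \<open>U\<close> as an operator on \<open>L\<^sup>2(\<mu>)\<close> when this space has the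
  same elements as \<open>L\<^sup>2(\<nu>)\<close>.
\<close>

lemma lp_operator_U_op:
  assumes p: "p \<in> {1, 2}" and M: "M \<in> {\<mu>, nu \<mu> \<kappa>}" "lp p M = lp p (nu \<mu> \<kappa>)"
  shows "lp_operator p M \<rho> U_op"
  unfolding lp_operator_def ae_linear_on_def
proof (intro conjI ballI allI impI)
  fix f g assume fg: "f \<in> lp p M" "g \<in> lp p M"
  show "AE z in \<rho>. U_op f z = U_op g z" if "AE x in M. f x = g x"
    using that M(1) AE_rho_marginals(1)[of "\<lambda>x. f x = g x"] by (auto simp: U_op_def AE_nu_iff)
  show "(\<lambda>x. a * f x + b * g x) \<in> lp p M" for a b
    using lp_linear_combination p fg by blast
next
  show "U_op ` lp p M \<subseteq> lp p \<rho>"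
    using M(2) lp_nu_measurable U_op_lp_iff by auto
qed (simp add: U_op_def)

lemma lp_isometry_U_op: "p \<in> {1, 2} \<Longrightarrow> lp_isometry p (nu \<mu> \<kappa>) \<rho> U_op"
  unfolding lp_isometry_def
  using lp_operator_U_op[of p "nu \<mu> \<kappa>"] lp_norm_distr[OF _ distr_rho_fst, of _ p] lp_nu_measurable
  by (auto simp: U_op_def)

text \<open>
  With \<open>G(x)\<close> the norm of \<open>g(x,\<cdot>)\<close> in \<open>L\<^sup>2(\<rho>\<^sub>x)\<close>, the function \<open>g\<close> belongs to \<open>L\<^sup>2(\<rho>)\<close> iff \<open>G\<close> belongs to \<open>L\<^sup>2(\<mu>)\<close>, and to \<open>L\<^sup>2(c\<rho>)\<close>
  iff \<open>G\<close> belongs to \<open>L\<^sup>2(\<nu>)\<close>.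
\<close>

lemma lp_2_crho_eq_lp_2_rho:
  assumes eq: "lp 2 \<mu> = lp 2 (nu \<mu> \<kappa>)"
  shows "lp 2 (crho \<rho> \<kappa>) = lp 2 \<rho>"
proof -
  have "g \<in> lp 2 \<rho> \<longleftrightarrow> g \<in> lp 2 (crho \<rho> \<kappa>)"
    if [measurable]: "g \<in> borel_measurable (borel \<Otimes>\<^sub>M borel)"
      and fin: "AE x in \<mu>. (\<integral>\<^sup>+y. ennreal ((g (x, y))\<^sup>2) \<partial>\<kappa> x) < \<infinity>" for g
  proof -
    \<comment> \<open>The norm in \<open>L\<^sup>2(\<rho>\<^sub>x)\<close> of the function \<open>g\<close> on the fibre over \<open>x\<close>.\<close>
    define G where "G x = sqrt (enn2real (\<integral>\<^sup>+y. ennreal ((g (x, y))\<^sup>2) \<partial>\<kappa> x))" for x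
    have [measurable]: "G \<in> borel_measurable borel" unfolding G_def by measurable
    have G: "AE x in \<mu>. ennreal ((G x)\<^sup>2) = (\<integral>\<^sup>+y. ennreal ((g (x, y))\<^sup>2) \<partial>\<kappa> x)"
      using fin by eventually_elim (simp add: G_def)
    have "(\<integral>\<^sup>+x. ennreal ((G x)\<^sup>2) \<partial>\<mu>) = (\<integral>\<^sup>+z. ennreal ((g z)\<^sup>2) \<partial>\<rho>)"
      using nn_integral_cong_AE[OF G] by (simp add: disintegration)
    then have "G \<in> lp 2 \<mu> \<longleftrightarrow> g \<in> lp 2 \<rho>"
      by (simp add: lp_2_iff_nn_integral)
    moreover have "(\<integral>\<^sup>+x. ennreal ((G x)\<^sup>2) \<partial>nu \<mu> \<kappa>) = (\<integral>\<^sup>+z. ennreal ((g z)\<^sup>2) \<partial>crho \<rho> \<kappa>)"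
      by (subst nn_integral_crho, simp, subst nn_integral_nu, simp, rule nn_integral_cong_AE)
        (use G in eventually_elim, simp)
    then have "G \<in> lp 2 (nu \<mu> \<kappa>) \<longleftrightarrow> g \<in> lp 2 (crho \<rho> \<kappa>)"
      by (simp add: lp_2_iff_nn_integral)
    ultimately show ?thesis using eq by simp
  qed
  then show ?thesis
    using AE_square_integrable_rho AE_square_integrable_crho lp_rho_measurable lp_crho_measurable
    by blast
qed

text \<open>
  Fubini's theorem for \<open>f(x) g(x,y)\<close>, where \<open>f(x)\<close> can be taken out of the fibre integral.
\<close>

lemma l2_inner_U_op:
  assumes f: "f \<in> borel_measurable borel" "U_op f \<in> lp 2 \<rho>" and g: "g \<in> lp 2 \<rho>"
  shows "l2_inner \<rho> (U_op f) g = l2_inner \<mu> f (Rt_op \<kappa> g)"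
proof -
  have "(\<lambda>z. f (fst z) * g z) \<in> lp 1 \<rho>"
    using integrable_mult_lp_2[OF f(2) g] by (simp add: lp_1_iff U_op_def)
  from Rt_op_integral(2)[OF this] show ?thesis
    by (simp add: l2_inner_def U_op_def Rt_op_fst_mult)
qed

lemma l2_adjoint_U_op:
  assumes eq: "lp 2 \<mu> = lp 2 (nu \<mu> \<kappa>)"
  shows "l2_adjoint \<mu> \<rho> U_op (Rt_op \<kappa>)"
    "f \<in> lp 2 \<mu> \<Longrightarrow> g \<in> lp 2 \<rho> \<Longrightarrow> l2_inner \<rho> (U_op f) g = l2_inner \<mu> f (Rt_op \<kappa> g)"
proof -
  show inner: "l2_inner \<rho> (U_op f) g = l2_inner \<mu> f (Rt_op \<kappa> g)" if "f \<in> lp 2 \<mu>" "g \<in> lp 2 \<rho>" for f g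
    using that lp_mu_measurable[OF that(1)] U_op_lp_iff[of f 2] eq by (intro l2_inner_U_op) auto
  have "lp_operator 2 \<rho> \<mu> (Rt_op \<kappa>)"
    using Rt_op_crho_bound(1) lp_2_crho_eq_lp_2_rho[OF eq] by (intro lp_operator_2_rho_Rt_op) simp
  moreover have "lp_operator 2 \<mu> \<rho> U_op"
    by (rule lp_operator_U_op) (use eq in simp_all)
  ultimately show "l2_adjoint \<mu> \<rho> U_op (Rt_op \<kappa>)"
    using inner by (simp add: l2_adjoint_def)
qed

text \<open>
  Inner products of indicators show that both measures agree on sets of finite measure, hence
  everywhere by continuity from below.
\<close>

lemma nu_eq_mu_if_l2_eq_hilbert:
  assumes eq: "l2_eq_hilbert \<mu> (nu \<mu> \<kappa>)"
  shows "nu \<mu> \<kappa> = \<mu>"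
proof (rule measure_eqI)
  have fin: "emeasure (nu \<mu> \<kappa>) A = emeasure \<mu> A" if A: "A \<in> Bfin \<mu>" for A
  proof -
    have ind: "(\<lambda>x. indicator A x * indicator A x) = (indicator A :: 'a \<Rightarrow> real)"
      by (auto split: split_indicator)
    have "(indicator A :: 'a \<Rightarrow> real) \<in> lp 2 \<mu>" using indicator_in_lp_2[OF A] .
    then have "l2_inner \<mu> (indicator A) (indicator A) = l2_inner (nu \<mu> \<kappa>) (indicator A) (indicator A)"
      using eq by (auto simp: l2_eq_hilbert_def)
    then have "measure \<mu> A = measure (nu \<mu> \<kappa>) A"
      using A by (simp add: l2_inner_def ind Bfin_def sets_mu sets_nu sets_eq_imp_space_eq[OF sets_nu])
    then show ?thesis
      using A nu_Bfin[OF A] emeasure_eq_ennreal_measure[of \<mu> A] emeasure_eq_ennreal_measure[of "nu \<mu> \<kappa>" A]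
      by (auto simp: Bfin_def less_top)
  qed
  fix X assume "X \<in> sets (nu \<mu> \<kappa>)"
  then have X [measurable]: "X \<in> sets borel" by (simp add: sets_nu)
  obtain A where A: "range A \<subseteq> sets \<mu>" "(\<Union>i. A i) = space \<mu>"
    "\<And>i::nat. emeasure \<mu> (A i) \<noteq> \<infinity>" "incseq A"
    using sigma_finite_measure.sigma_finite_incseq[OF sigma_finite_mu] by metis
  have inc: "incseq (\<lambda>i. X \<inter> A i)" using A(4) unfolding incseq_def by blast
  have un: "(\<Union>i. X \<inter> A i) = X" using A(2) by auto
  have B: "X \<inter> A i \<in> Bfin \<mu>" for i
  proof -
    have "emeasure \<mu> (X \<inter> A i) \<le> emeasure \<mu> (A i)" using A(1) by (intro emeasure_mono) auto
    also have "\<dots> < \<infinity>" using A(3) by (simp add: less_top)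
    finally show ?thesis using A(1) X by (auto simp: Bfin_def sets_mu)
  qed
  have "emeasure M X = (SUP i. emeasure M (X \<inter> A i))" if "sets M = sets borel" for M
  proof -
    have "range (\<lambda>i. X \<inter> A i) \<subseteq> sets M" using B that by (auto simp: Bfin_def sets_mu)
    from SUP_emeasure_incseq[OF this inc] show ?thesis unfolding un by (rule sym)
  qed
  then show "emeasure (nu \<mu> \<kappa>) X = emeasure \<mu> X" using fin[OF B] by (simp add: sets_nu sets_mu)
qed (simp add: sets_nu sets_mu)

lemma crho_eq_rho_if_nu_eq_mu:
  assumes eq: "nu \<mu> \<kappa> = \<mu>"
  shows "crho \<rho> \<kappa> = \<rho>"
proof -
  have "density \<mu> (mass \<kappa>) = density \<mu> (\<lambda>_. 1)"
    using eq by (simp add: nu_def density_1)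
  then have "AE x in \<mu>. mass \<kappa> x = 1"
    by (subst (asm) sigma_finite_measure.density_unique_iff[OF sigma_finite_mu]) auto
  from AE_rho_marginals(1)[OF this] have "crho \<rho> \<kappa> = density \<rho> (\<lambda>_. 1)"
    unfolding crho_def by (intro density_cong) (auto simp: case_prod_beta)
  then show ?thesis by (simp add: density_1)
qed

lemma l2_co_isometry_Rt_op:
  assumes nu: "nu \<mu> \<kappa> = \<mu>"
  shows "l2_co_isometry \<rho> \<mu> (Rt_op \<kappa>)"
  unfolding l2_co_isometry_def
proof (intro conjI exI)
  have crho: "crho \<rho> \<kappa> = \<rho>" using crho_eq_rho_if_nu_eq_mu[OF nu] .
  show "bounded_lp_operator 2 \<rho> \<mu> (Rt_op \<kappa>)"
    using bounded_lp_operatorI(1)[OF lp_operator_2_crho_Rt_op _ Rt_op_crho_bound(2)] by (simp add: crho)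
  show "l2_adjoint \<rho> \<mu> (Rt_op \<kappa>) U_op"
    using l2_adjoint_U_op(1) nu by (auto simp: l2_adjoint_def l2_inner_def mult.commute)
  show "lp_isometry 2 \<mu> \<rho> U_op" using lp_isometry_U_op[of 2] nu by simp
qed

section \<open>The operator on functions of one variable\<close>

text \<open>
  The reduction of \<open>R\<close> to fibre integrals; the lift \<open>f \<circ> snd\<close> is controlled by the second marginal of \<open>\<rho>\<close>.
\<close>

lemma R_op_eq_Rt_op: "R_op \<kappa> f = Rt_op \<kappa> (f \<circ> snd)"
  by (simp add: R_op_def Rt_op_def fun_eq_iff)

lemma R_dom_iff: "f \<in> R_dom \<mu> \<kappa> \<longleftrightarrow> f \<circ> snd \<in> Rt_dom \<mu> \<kappa>"
  by (simp add: R_dom_def Rt_dom_def slice_def)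

lemma comp_snd_lp_iff: "f \<in> borel_measurable borel \<Longrightarrow> f \<circ> snd \<in> lp p \<rho> \<longleftrightarrow> f \<in> lp p (nu \<mu> \<kappa>)"
  using lp_distr_iff[OF _ distr_rho_snd, of f p] by simp

lemma lp_norm_comp_snd: "f \<in> borel_measurable borel \<Longrightarrow> lp_norm p \<rho> (f \<circ> snd) = lp_norm p (nu \<mu> \<kappa>) f"
  using lp_norm_distr[OF _ distr_rho_snd] by simp

lemma measurable_R_op: "f \<in> borel_measurable borel \<Longrightarrow> R_op \<kappa> f \<in> borel_measurable borel"
  unfolding R_op_eq_Rt_op by (intro measurable_Rt_op) (simp add: comp_def)

lemma ae_linear_on_R_op:
  assumes D: "D \<subseteq> borel_measurable borel" "D \<subseteq> R_dom \<mu> \<kappa>"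
    and lin: "\<And>f g a b. f \<in> D \<Longrightarrow> g \<in> D \<Longrightarrow> (\<lambda>x. a * f x + b * g x) \<in> D"
    and M: "M \<in> {\<mu>, nu \<mu> \<kappa>}"
  shows "ae_linear_on D M \<mu> (R_op \<kappa>)"
  unfolding ae_linear_on_def
proof (intro conjI ballI allI impI)
  fix f g assume fg: "f \<in> D" "g \<in> D"
  then have [measurable]: "f \<in> borel_measurable borel" "g \<in> borel_measurable borel" using D by auto
  show "AE x in \<mu>. R_op \<kappa> f x = R_op \<kappa> g x" if "AE x in M. f x = g x"
  proof -
    have "AE x in \<mu>. f x = g x" using M that by (auto simp: AE_nu_iff)
    from AE_rho_imp_AE_kernel[OF AE_rho_marginals(2)[OF this]] show ?thesis
      by eventually_elim (auto simp: R_op_def intro!: integral_cong_AE)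
  qed
  fix a b :: real
  show "(\<lambda>x. a * f x + b * g x) \<in> D" using lin fg .
  have "AE x in \<mu>. integrable (\<kappa> x) f" "AE x in \<mu>. integrable (\<kappa> x) g"
    using D fg by (auto simp: R_dom_def)
  then show "AE x in \<mu>. R_op \<kappa> (\<lambda>x. a * f x + b * g x) x = a * R_op \<kappa> f x + b * R_op \<kappa> g x"
    by eventually_elim (auto simp: R_op_def)
qed

lemma lp_1_nu_subset_R_dom: "lp 1 (nu \<mu> \<kappa>) \<subseteq> R_dom \<mu> \<kappa>"
  using lp_1_rho_subset_Rt_dom comp_snd_lp_iff lp_nu_measurable by (blast intro: R_dom_iff[THEN iffD2])

lemma lp_contraction_R_op: "lp_contraction 1 (nu \<mu> \<kappa>) \<mu> (R_op \<kappa>)"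
proof -
  have "ae_linear_on (lp 1 (nu \<mu> \<kappa>)) (nu \<mu> \<kappa>) \<mu> (R_op \<kappa>)"
    by (rule ae_linear_on_R_op) (auto simp: lp_nu_measurable lp_linear_combination lp_1_nu_subset_R_dom)
  moreover have "R_op \<kappa> f \<in> lp 1 \<mu>" "lp_norm 1 \<mu> (R_op \<kappa> f) \<le> lp_norm 1 (nu \<mu> \<kappa>) f"
    if f: "f \<in> lp 1 (nu \<mu> \<kappa>)" for f
  proof -
    note m = lp_nu_measurable[OF f]
    have "f \<circ> snd \<in> lp 1 \<rho>" using f comp_snd_lp_iff[OF m] by simp
    then show "R_op \<kappa> f \<in> lp 1 \<mu>" "lp_norm 1 \<mu> (R_op \<kappa> f) \<le> lp_norm 1 (nu \<mu> \<kappa>) f"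
      unfolding R_op_eq_Rt_op lp_norm_comp_snd[OF m, symmetric]
      by (rule Rt_op_integral(1) Rt_op_norm_1_le)+
  qed
  ultimately show ?thesis by (auto simp: lp_contraction_def lp_operator_def)
qed

lemma nu_eq_density_rmass: "nu \<mu> \<kappa> = density \<mu> (\<lambda>x. ennreal (rmass \<kappa> x))"
  unfolding nu_def
  by (rule density_cong) (use AE_kernel_finite in \<open>auto elim: AE_mp\<close>)

lemma integral_R_op:
  assumes f: "f \<in> lp 1 (nu \<mu> \<kappa>)"
  shows "(\<integral>x. R_op \<kappa> f x \<partial>\<mu>) = (\<integral>x. f x * rmass \<kappa> x \<partial>\<mu>)"
proof -
  note [measurable] = lp_nu_measurable[OF f]
  have "f \<circ> snd \<in> lp 1 \<rho>" using f comp_snd_lp_iff by simp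
  then have "(\<integral>x. R_op \<kappa> f x \<partial>\<mu>) = (\<integral>z. f (snd z) \<partial>\<rho>)"
    using Rt_op_integral(2)[of "f \<circ> snd"] by (simp add: R_op_eq_Rt_op comp_def)
  also have "\<dots> = (\<integral>x. f x \<partial>nu \<mu> \<kappa>)"
    unfolding distr_rho_snd[symmetric] by (subst integral_distr) auto
  also have "\<dots> = (\<integral>x. rmass \<kappa> x * f x \<partial>\<mu>)"
    unfolding nu_eq_density_rmass by (subst integral_density) (auto simp: rmass_def)
  finally show ?thesis by (simp add: mult.commute)
qed

text \<open>
  The value of \<open>\<mu>R\<close> on \<open>A\<close> is \<open>\<rho>(V \<times> A) = \<rho>(A \<times> V)\<close>. As \<open>\<mu>R\<close> is built by the constructor for measures, the
  equality of the two set functions on the sigma-algebra suffices: it is countably additive because the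
  other one is.
\<close>

lemma nu_eq_muR: "nu \<mu> \<kappa> = muR \<mu> \<kappa>"
  unfolding nu_def density_def muR_def
proof (rule measure_of_eq)
  fix A assume "A \<in> sigma_sets (space \<mu>) (sets \<mu>)"
  then have A: "A \<in> sets borel" by (metis sets.sigma_sets_eq sets_mu)
  have "(\<integral>\<^sup>+x. mass \<kappa> x * indicator A x \<partial>\<mu>) = emeasure (nu \<mu> \<kappa>) A"
    using A by (simp add: nu_def emeasure_density sets_mu)
  also have "\<dots> = emeasure \<rho> (UNIV \<times> A)"
    using A by (simp add: emeasure_nu symmetric_rho)
  also have "\<dots> = (\<integral>\<^sup>+x. (\<integral>\<^sup>+y. indicator A y \<partial>\<kappa> x) \<partial>\<mu>)"
    using A by (simp add: emeasure_rho_times sets_kernel)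
  finally show "(\<integral>\<^sup>+x. mass \<kappa> x * indicator A x \<partial>\<mu>) = (\<integral>\<^sup>+x. (\<integral>\<^sup>+y. indicator A y \<partial>\<kappa> x) \<partial>\<mu>)" .
qed (rule sets.space_closed)

lemma RN_deriv_muR: "AE x in \<mu>. RN_deriv \<mu> (muR \<mu> \<kappa>) x = mass \<kappa> x"
proof -
  have "AE x in \<mu>. mass \<kappa> x = RN_deriv \<mu> (muR \<mu> \<kappa>) x"
    by (rule sigma_finite_measure.RN_deriv_unique[OF sigma_finite_mu])
      (simp_all add: nu_eq_muR[symmetric] nu_def)
  then show ?thesis by eventually_elim simp
qed

text \<open>
  The lift \<open>f \<circ> snd\<close> has the norm of \<open>f\<close> in \<open>L\<^sup>2(\<nu>)\<close>, so this estimate supplies one of the two square roots of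
  \<open>\<parallel>c\<parallel>\<^sub>\<infinity>\<close> in the norm of \<open>R\<close>.
\<close>

lemma lp_2_mu_nu_bound:
  assumes c: "rmass \<kappa> \<in> linf \<mu>" and f: "f \<in> lp 2 \<mu>"
  shows "f \<in> lp 2 (nu \<mu> \<kappa>)"
    "lp_norm 2 (nu \<mu> \<kappa>) f \<le> sqrt (linf_norm \<mu> (rmass \<kappa>)) * lp_norm 2 \<mu> f"
proof -
  let ?C = "linf_norm \<mu> (rmass \<kappa>)"
  note m [measurable] = lp_mu_measurable[OF f]
  have "(\<integral>\<^sup>+x. ennreal ((f x)\<^sup>2) \<partial>nu \<mu> \<kappa>) = (\<integral>\<^sup>+x. mass \<kappa> x * ennreal ((f x)\<^sup>2) \<partial>\<mu>)"
    by (simp add: nn_integral_nu)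
  also have "\<dots> \<le> (\<integral>\<^sup>+x. ennreal ?C * ennreal ((f x)\<^sup>2) \<partial>\<mu>)"
    by (rule nn_integral_mono_AE)
      (use rmass_AE_bound(1)[OF c] in \<open>eventually_elim, auto intro: mult_right_mono\<close>)
  also have "\<dots> = ennreal ?C * (\<integral>\<^sup>+x. ennreal ((f x)\<^sup>2) \<partial>\<mu>)"
    by (simp add: nn_integral_cmult)
  finally have le: "(\<integral>\<^sup>+x. ennreal ((f x)\<^sup>2) \<partial>nu \<mu> \<kappa>) \<le> ennreal ?C * (\<integral>\<^sup>+x. ennreal ((f x)\<^sup>2) \<partial>\<mu>)" .
  show "f \<in> lp 2 (nu \<mu> \<kappa>)" "lp_norm 2 (nu \<mu> \<kappa>) f \<le> sqrt ?C * lp_norm 2 \<mu> f"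
    using lp_2_bound[OF f _ rmass_AE_bound(2)[OF c] le] by simp_all
qed

lemma R_op_bounded:
  assumes c: "rmass \<kappa> \<in> linf \<mu>"
  shows "lp 2 \<mu> \<subseteq> R_dom \<mu> \<kappa>" "bounded_lp_operator 2 \<mu> \<mu> (R_op \<kappa>)"
    "lp_opnorm 2 \<mu> \<mu> (R_op \<kappa>) \<le> linf_norm \<mu> (rmass \<kappa>)"
proof -
  let ?C = "linf_norm \<mu> (rmass \<kappa>)"
  have C: "0 \<le> ?C" using rmass_AE_bound(2)[OF c] .
  have rho: "f \<circ> snd \<in> lp 2 \<rho>" if "f \<in> lp 2 \<mu>" for f
    using lp_2_mu_nu_bound(1)[OF c that] comp_snd_lp_iff[OF lp_mu_measurable[OF that]] by simp
  then show dom: "lp 2 \<mu> \<subseteq> R_dom \<mu> \<kappa>"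
    using lp_2_rho_subset_Rt_dom by (blast intro: R_dom_iff[THEN iffD2])
  have le: "lp_norm 2 \<mu> (R_op \<kappa> f) \<le> ?C * lp_norm 2 \<mu> f" if f: "f \<in> lp 2 \<mu>" for f
  proof -
    have "lp_norm 2 \<mu> (R_op \<kappa> f) \<le> sqrt ?C * lp_norm 2 \<rho> (f \<circ> snd)"
      unfolding R_op_eq_Rt_op by (rule Rt_op_rho_bound(2)[OF c rho[OF f]])
    also have "\<dots> = sqrt ?C * lp_norm 2 (nu \<mu> \<kappa>) f"
      using lp_norm_comp_snd[OF lp_mu_measurable[OF f]] by simp
    also have "\<dots> \<le> sqrt ?C * (sqrt ?C * lp_norm 2 \<mu> f)"
      using lp_2_mu_nu_bound(2)[OF c f] C by (intro mult_left_mono) auto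
    also have "\<dots> = ?C * lp_norm 2 \<mu> f"
      using C by (simp add: mult.assoc[symmetric])
    finally show ?thesis .
  qed
  have "ae_linear_on (lp 2 \<mu>) \<mu> \<mu> (R_op \<kappa>)"
    by (rule ae_linear_on_R_op) (auto simp: lp_mu_measurable lp_linear_combination dom)
  moreover have "R_op \<kappa> f \<in> lp 2 \<mu>" if "f \<in> lp 2 \<mu>" for f
    unfolding R_op_eq_Rt_op by (rule Rt_op_rho_bound(1)[OF c rho[OF that]])
  ultimately have op: "lp_operator 2 \<mu> \<mu> (R_op \<kappa>)" by (auto simp: lp_operator_def)
  show "bounded_lp_operator 2 \<mu> \<mu> (R_op \<kappa>)" "lp_opnorm 2 \<mu> \<mu> (R_op \<kappa>) \<le> ?C"
    using bounded_lp_operatorI[OF op C le] by auto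
qed

lemma l2_inner_R_op:
  assumes "integrable \<rho> (\<lambda>z. g (fst z) * f (snd z))"
  shows "l2_inner \<mu> g (R_op \<kappa> f) = (\<integral>z. g (fst z) * f (snd z) \<partial>\<rho>)"
  using Rt_op_integral(2)[of "\<lambda>z. g (fst z) * f (snd z)"] assms
  by (simp add: lp_1_iff l2_inner_def Rt_op_def R_op_def)

lemma integral_rho_swap:
  fixes h :: "'a \<times> 'a \<Rightarrow> real"
  assumes [measurable]: "h \<in> borel_measurable (borel \<Otimes>\<^sub>M borel)"
  shows "(\<integral>z. h z \<partial>\<rho>) = (\<integral>z. h (snd z, fst z) \<partial>\<rho>)"
proof -
  have "(\<integral>z. h z \<partial>distr \<rho> (borel \<Otimes>\<^sub>M borel) (\<lambda>(x, y). (y, x))) = (\<integral>z. h (snd z, fst z) \<partial>\<rho>)"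
    by (subst integral_distr) (auto simp: case_prod_beta)
  then show ?thesis by (simp only: distr_rho_swap)
qed

text \<open>
  By local integrability of \<open>c\<close>; this already defines \<open>R\<close> on the span, as an operator into \<open>L\<^sup>1(\<mu>)\<close>.
\<close>

lemma span_Bfin_subset_lp_1_nu: "span_Bfin \<mu> \<subseteq> lp 1 (nu \<mu> \<kappa>)"
proof
  fix f assume "f \<in> span_Bfin \<mu>"
  then show "f \<in> lp 1 (nu \<mu> \<kappa>)"
  proof (induction rule: span_Bfin_induct)
    case (add f a A)
    then show ?case
      using nu_Bfin[of A] by (simp add: lp_1_iff Bfin_def sets_nu sets_mu)
  qed (simp add: lp_1_iff)
qed

text \<open>
  The hypothesis is exactly that \<open>R\<close> maps indicators into \<open>L\<^sup>2(\<mu>)\<close>, which extends to the span by linearity. For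
  the symmetry, \<open>g(x) f(y)\<close> is integrable with respect to \<open>\<rho>\<close>, as \<open>g\<close> is bounded and \<open>f \<circ> snd\<close> is integrable.
\<close>

lemma symmetric_l2_operator_R_op:
  assumes L2: "\<And>A. A \<in> Bfin \<mu> \<Longrightarrow> (\<lambda>x. measure (\<kappa> x) A) \<in> lp 2 \<mu>"
  shows "span_Bfin \<mu> \<subseteq> R_dom \<mu> \<kappa>" "symmetric_l2_operator \<mu> (span_Bfin \<mu>) (R_op \<kappa>)"
proof -
  show dom: "span_Bfin \<mu> \<subseteq> R_dom \<mu> \<kappa>"
    using span_Bfin_subset_lp_1_nu lp_1_nu_subset_R_dom by blast
  have meas: "f \<in> borel_measurable borel" if "f \<in> span_Bfin \<mu>" for f
    using lp_nu_measurable span_Bfin_subset_lp_1_nu that by blast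
  have lin: "ae_linear_on (span_Bfin \<mu>) \<mu> \<mu> (R_op \<kappa>)"
    by (rule ae_linear_on_R_op) (auto simp: meas dom span_Bfin_linear_combination)
  have range: "R_op \<kappa> f \<in> lp 2 \<mu>" if "f \<in> span_Bfin \<mu>" for f
  proof -
    from that have "f \<in> span_Bfin \<mu> \<and> R_op \<kappa> f \<in> lp 2 \<mu>"
    proof (induction rule: span_Bfin_induct)
      case zero
      then show ?case by (simp add: R_op_def lp_2_iff zero_in_span_Bfin)
    next
      case (add f a A)
      let ?h = "\<lambda>x. a * indicator A x + 1 * f x"
      have A: "indicator A \<in> span_Bfin \<mu>" using add indicator_in_span_Bfin by blast
      have h: "?h \<in> span_Bfin \<mu>" using A add span_Bfin_linear_combination by blast
      have "R_op \<kappa> (indicator A) = (\<lambda>x. measure (\<kappa> x) A)"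
        using add by (simp add: R_op_def fun_eq_iff Bfin_def sets_mu)
      then have "(\<lambda>x. a * R_op \<kappa> (indicator A) x + 1 * R_op \<kappa> f x) \<in> lp 2 \<mu>"
        using L2 add by (intro lp_linear_combination) auto
      moreover have "AE x in \<mu>. R_op \<kappa> ?h x = a * R_op \<kappa> (indicator A) x + 1 * R_op \<kappa> f x"
        using lin A add unfolding ae_linear_on_def by blast
      moreover have "R_op \<kappa> ?h \<in> borel_measurable \<mu>"
        using measurable_R_op[OF meas[OF h]] by simp
      ultimately have "R_op \<kappa> ?h \<in> lp 2 \<mu>" by (elim lp_cong_AE) auto
      then show ?case using h by simp
    qed
    then show ?thesis ..
  qed
  have int: "integrable \<rho> (\<lambda>z. g (fst z) * f (snd z))" if fg: "f \<in> span_Bfin \<mu>" "g \<in> span_Bfin \<mu>" for f g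
  proof -
    note [measurable] = fg[THEN meas]
    obtain K where K: "\<And>x. \<bar>g x\<bar> \<le> K" using span_Bfin_bounded[OF fg(2)] by blast
    have "f \<circ> snd \<in> lp 1 \<rho>" using fg(1) span_Bfin_subset_lp_1_nu comp_snd_lp_iff by auto
    then have i: "integrable \<rho> (\<lambda>z. K * f (snd z))" by (simp add: lp_1_iff comp_def)
    show ?thesis
    proof (rule Bochner_Integration.integrable_bound[OF i])
      show "AE z in \<rho>. norm (g (fst z) * f (snd z)) \<le> norm (K * f (snd z))"
        by (intro AE_I2) (auto simp: abs_mult intro!: mult_right_mono order_trans[OF K])
    qed measurable
  qed
  have "l2_inner \<mu> g (R_op \<kappa> f) = l2_inner \<mu> (R_op \<kappa> g) f"
    if fg: "f \<in> span_Bfin \<mu>" "g \<in> span_Bfin \<mu>" for f g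
  proof -
    note [measurable] = fg[THEN meas]
    have "l2_inner \<mu> g (R_op \<kappa> f) = (\<integral>z. g (fst z) * f (snd z) \<partial>\<rho>)"
      by (simp add: l2_inner_R_op int fg)
    also have "\<dots> = (\<integral>z. f (fst z) * g (snd z) \<partial>\<rho>)"
      by (subst integral_rho_swap) (simp_all add: mult.commute)
    also have "\<dots> = l2_inner \<mu> f (R_op \<kappa> g)" by (simp add: l2_inner_R_op int fg)
    finally show ?thesis by (simp add: l2_inner_def mult.commute)
  qed
  then show "symmetric_l2_operator \<mu> (span_Bfin \<mu>) (R_op \<kappa>)"
    using lin range span_Bfin_subset_lp_2[of \<mu>] span_Bfin_dense[of _ \<mu>]
    unfolding symmetric_l2_operator_def by (simp add: image_subset_iff)
qed

end

section \<open>The properties of both operators\<close>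

theorem theorem3p3:
  fixes \<mu> :: "'a::polish_space measure"
    and \<rho> :: "('a \<times> 'a) measure"
    and E :: "('a \<times> 'a) set"
    and \<kappa> :: "'a \<Rightarrow> 'a measure"
  assumes "symmetric_measure_system \<mu> \<rho> E \<kappa>"
  shows
    "(\<comment> \<open>(1)\<close>
      lp 1 \<rho> \<subseteq> Rt_dom \<mu> \<kappa> \<and>
      lp_operator 1 \<rho> \<mu> (Rt_op \<kappa>) \<and>
      lp_onto 1 \<rho> \<mu> (Rt_op \<kappa>) \<and>
      (\<forall>f\<in>lp 1 \<rho>. (\<integral>z. f z \<partial>\<rho>) = (\<integral>x. Rt_op \<kappa> f x \<partial>\<mu>)) \<and>
      \<not> lp_one_to_one 1 \<rho> \<mu> (Rt_op \<kappa>)) \<and>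
     (\<comment> \<open>(2)\<close>
      \<forall>g\<in>linf \<mu>. \<forall>f\<in>lp 1 \<rho>.
        (\<lambda>z. (g \<circ> fst) z * f z) \<in> lp 1 \<rho> \<and>
        (AE x in \<mu>. Rt_op \<kappa> (\<lambda>z. (g \<circ> fst) z * f z) x = g x * Rt_op \<kappa> f x)) \<and>
     (\<comment> \<open>(3)\<close>
      lp 2 (crho \<rho> \<kappa>) \<subseteq> Rt_dom \<mu> \<kappa> \<and>
      bounded_lp_operator 2 (crho \<rho> \<kappa>) \<mu> (Rt_op \<kappa>) \<and>
      lp_opnorm 2 (crho \<rho> \<kappa>) \<mu> (Rt_op \<kappa>) \<le> 1) \<and>
     (\<comment> \<open>(4); for \<open>\<parallel>c\<parallel>\<^sub>\<infinity> < 1\<close> the bound needs a square root\<close>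
      rmass \<kappa> \<in> linf \<mu> \<longrightarrow>
        bounded_lp_operator 2 \<rho> \<mu> (Rt_op \<kappa>) \<and>
        (lp_opnorm 2 \<rho> \<mu> (Rt_op \<kappa>))\<^sup>2 \<le> linf_norm \<mu> (rmass \<kappa>) \<and>
        (1 \<le> linf_norm \<mu> (rmass \<kappa>) \<longrightarrow>
          lp_opnorm 2 \<rho> \<mu> (Rt_op \<kappa>) \<le> linf_norm \<mu> (rmass \<kappa>))) \<and>
     (\<comment> \<open>(5)\<close>
      \<forall>p\<in>{1, 2}. lp_isometry p (nu \<mu> \<kappa>) \<rho> U_op) \<and>
     (\<comment> \<open>(6), for equality as sets of functions, and as Hilbert spaces\<close>
      (lp 2 \<mu> = lp 2 (nu \<mu> \<kappa>) \<longrightarrow>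
        lp 2 (crho \<rho> \<kappa>) = lp 2 \<rho> \<and>
        (\<forall>f\<in>lp 2 \<mu>. \<forall>g\<in>lp 2 \<rho>. l2_inner \<rho> (U_op f) g = l2_inner \<mu> f (Rt_op \<kappa> g)) \<and>
        l2_adjoint \<mu> \<rho> U_op (Rt_op \<kappa>)) \<and>
      (l2_eq_hilbert \<mu> (nu \<mu> \<kappa>) \<longrightarrow>
        l2_eq_hilbert (crho \<rho> \<kappa>) \<rho> \<and>
        l2_co_isometry \<rho> \<mu> (Rt_op \<kappa>))) \<and>
     (\<comment> \<open>(7)\<close>
      \<forall>p\<in>{1, 2}. \<forall>f\<in>lp p \<rho>. f \<in> Rt_dom \<mu> \<kappa> \<and>
        (AE x in \<mu>. Rt_op \<kappa> f x = R_op \<kappa> (slice x f) x)) \<and>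
     (\<comment> \<open>(8)\<close>
      rmass \<kappa> \<in> linf \<mu> \<longrightarrow>
        lp 2 \<mu> \<subseteq> R_dom \<mu> \<kappa> \<and>
        bounded_lp_operator 2 \<mu> \<mu> (R_op \<kappa>) \<and>
        lp_opnorm 2 \<mu> \<mu> (R_op \<kappa>) \<le> linf_norm \<mu> (rmass \<kappa>)) \<and>
     (\<comment> \<open>(9)\<close>
      (\<forall>A\<in>Bfin \<mu>. (\<lambda>x. measure (\<kappa> x) A) \<in> lp 2 \<mu>) \<longrightarrow>
        span_Bfin \<mu> \<subseteq> R_dom \<mu> \<kappa> \<and>
        symmetric_l2_operator \<mu> (span_Bfin \<mu>) (R_op \<kappa>)) \<and>
     (\<comment> \<open>(10)\<close>
      lp 1 (nu \<mu> \<kappa>) \<subseteq> R_dom \<mu> \<kappa> \<and>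
      lp_contraction 1 (nu \<mu> \<kappa>) \<mu> (R_op \<kappa>) \<and>
      (\<forall>f\<in>lp 1 (nu \<mu> \<kappa>). (\<integral>x. R_op \<kappa> f x \<partial>\<mu>) = (\<integral>x. f x * rmass \<kappa> x \<partial>\<mu>)) \<and>
      nu \<mu> \<kappa> = muR \<mu> \<kappa> \<and>
      (AE x in \<mu>. RN_deriv \<mu> (muR \<mu> \<kappa>) x = mass \<kappa> x))"
proof -
  interpret symmetric_measure_system \<mu> \<rho> E \<kappa> by fact
  have linf: "(\<lambda>z. (g \<circ> fst) z * f z) \<in> lp 1 \<rho> \<and>
      (AE x in \<mu>. Rt_op \<kappa> (\<lambda>z. (g \<circ> fst) z * f z) x = g x * Rt_op \<kappa> f x)"
    if "g \<in> linf \<mu>" "f \<in> lp 1 \<rho>" for g f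
    using linf_mult_lp_1[OF that] by (simp add: Rt_op_fst_mult)
  have crho: "bounded_lp_operator 2 (crho \<rho> \<kappa>) \<mu> (Rt_op \<kappa>)" "lp_opnorm 2 (crho \<rho> \<kappa>) \<mu> (Rt_op \<kappa>) \<le> 1"
    using bounded_lp_operatorI[OF lp_operator_2_crho_Rt_op zero_le_one Rt_op_crho_bound(2)] by auto
  have hilbert: "l2_eq_hilbert (crho \<rho> \<kappa>) \<rho> \<and> l2_co_isometry \<rho> \<mu> (Rt_op \<kappa>)"
    if "l2_eq_hilbert \<mu> (nu \<mu> \<kappa>)"
  proof -
    have nu: "nu \<mu> \<kappa> = \<mu>" using nu_eq_mu_if_l2_eq_hilbert[OF that] .
    show ?thesis
      using crho_eq_rho_if_nu_eq_mu[OF nu] l2_co_isometry_Rt_op[OF nu] by (simp add: l2_eq_hilbert_def)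
  qed
  have slices: "f \<in> Rt_dom \<mu> \<kappa> \<and> (AE x in \<mu>. Rt_op \<kappa> f x = R_op \<kappa> (slice x f) x)"
    if "p \<in> {1, 2}" "f \<in> lp p \<rho>" for p f
    using that lp_1_rho_subset_Rt_dom lp_2_rho_subset_Rt_dom by (auto simp: Rt_op_def R_op_def slice_def)
  show ?thesis
    by (intro conjI ballI impI)
      (simp_all only: lp_1_rho_subset_Rt_dom lp_operator_1_Rt_op lp_onto_Rt_op Rt_op_integral(2)
        not_lp_one_to_one_Rt_op linf lp_2_crho_subset_Rt_dom crho Rt_op_rho_bounded lp_isometry_U_op
        lp_2_crho_eq_lp_2_rho l2_adjoint_U_op hilbert slices R_op_bounded
        symmetric_l2_operator_R_op lp_1_nu_subset_R_dom lp_contraction_R_op integral_R_op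
        nu_eq_muR[symmetric] RN_deriv_muR[folded nu_eq_muR] not_False_eq_True)
qed

end
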